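(* For $n<3$, $p(n,n-2)=u(n,n-2)=0$, and for every integer $n\ge3$, \[ p(n,n-2)=\tfrac16\,(n-2)\bigl(n^3-2n^2-5n+12\bigr),\qquad u(n,n-2)=\tfrac16\,(n-3)\bigl(n^3-4n^2+2n-2\bigr). \]
   Context: $p(n,l)$ is the number of isomorphism classes of posets with $n$ elements whose longest chain has exactly $l$ elements; $u(n,l)$ is the number of those which are locally unsymmetric. Definitions: $\ell(X)$ is the cardinality of a longest chain of a poset $X$. A subset $A$ of a poset $X$ is maximally ordered in $X$ if $|\{(a,b)\in A\times A:a<b\}|$ is maximal among subsets of $X$ of cardinality $|A|$. For $\sigma\in\mathrm{Aut}(P)$, $\Sigma(\sigma)=\{a:\sigma(a)\ne a\}$. For a finite poset $Q$ and $r\ge2$: $\sigma$ is a $(Q,r)$-generator if there exist subsets $S_0,\dots,S_{r-1}\subset\Sigma(\sigma)$, each isomorphic to $Q$, which are smallest maximally ordered subsets of $\Sigma(\sigma)$ with $\sigma(S_i)=S_{(i+1)\bmod r}$, $\ell(S_i)=\ell(\Sigma(\sigma))$, $\bigcup_iS_i=\Sigma(\sigma)$; distinct $S_i,S_j$ are $(Q,r)$-symmetric subsets. Elements $a,b$ are $(Q,r,0)$-symmetric if $a=b$; $(Q,r,1)$-symmetric if there are $(Q,r)$-symmetric subsets $A,B$ with generator $\sigma$, $a\in A$, $b=\sigma^q(a)\in B$, $1\le q<r$; for $m\ge2$, $(Q,r,m)$-symmetric if not $(Q,r,j)$-symmetric for $j<m$ but there exist $c$, $j<m$ with $a$ $(Q,r,j)$-symmetric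 to $c$ and $c$ $(Q,r,m-j)$-symmetric to $b$; $(Q,r)$-symmetric if $(Q,r,m)$-symmetric for some $m\ge0$ (an equivalence relation). $P\oslash_rQ$ is the quotient poset of equivalence classes with $E\le F$ iff some $e\in E$, $f\in F$ satisfy $e\le f$. A poset $P$ is locally symmetric if $P\oslash_rQ\not\cong P$ for some finite poset $Q$ and some $r\ge2$; it is locally unsymmetric otherwise. *)

theory Defs
  imports Complex_Main
begin

text \<open>A finite poset is given by a carrier set A and an order relation le (only its
restriction to A matters).\<close>

definition po_on :: "'a set \<Rightarrow> ('a \<Rightarrow> 'a \<Rightarrow> bool) \<Rightarrow> bool" where
  "po_on A le \<longleftrightarrow> (\<forall>x\<in>A. le x x) \<and> (\<forall>x\<in>A. \<forall>y\<in>A. le x y \<and> le y x \<longrightarrow> x = y)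
     \<and> (\<forall>x\<in>A. \<forall>y\<in>A. \<forall>z\<in>A. le x y \<and> le y z \<longrightarrow> le x z)"

definition is_chain :: "'a set \<Rightarrow> ('a \<Rightarrow> 'a \<Rightarrow> bool) \<Rightarrow> bool" where
  "is_chain C le \<longleftrightarrow> (\<forall>x\<in>C. \<forall>y\<in>C. le x y \<or> le y x)"

definition ell :: "'a set \<Rightarrow> ('a \<Rightarrow> 'a \<Rightarrow> bool) \<Rightarrow> nat" where
  "ell B le = Max (card ` {C. C \<subseteq> B \<and> is_chain C le})"

definition order_iso :: "'a set \<Rightarrow> ('a \<Rightarrow> 'a \<Rightarrow> bool) \<Rightarrow> 'b set \<Rightarrow> ('b \<Rightarrow> 'b \<Rightarrow> bool) \<Rightarrow> bool" where
  "order_iso A le B le' \<longleftrightarrow> (\<exists>f. bij_betw f A B \<and> (\<forall>x\<in>A. \<forall>y\<in>A. le x y \<longleftrightarrow> le' (f x) (f y)))"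

definition poset_aut :: "'a set \<Rightarrow> ('a \<Rightarrow> 'a \<Rightarrow> bool) \<Rightarrow> ('a \<Rightarrow> 'a) \<Rightarrow> bool" where
  "poset_aut A le \<sigma> \<longleftrightarrow> bij_betw \<sigma> A A \<and> (\<forall>x\<in>A. \<forall>y\<in>A. le x y \<longleftrightarrow> le (\<sigma> x) (\<sigma> y))"

definition moved :: "'a set \<Rightarrow> ('a \<Rightarrow> 'a) \<Rightarrow> 'a set" where
  "moved A \<sigma> = {a \<in> A. \<sigma> a \<noteq> a}"

definition ord_pairs :: "'a set \<Rightarrow> ('a \<Rightarrow> 'a \<Rightarrow> bool) \<Rightarrow> nat" where
  "ord_pairs B le = card {(a, b). a \<in> B \<and> b \<in> B \<and> le a b \<and> a \<noteq> b}"

definition max_ordered :: "'a set \<Rightarrow> ('a \<Rightarrow> 'a \<Rightarrow> bool) \<Rightarrow> 'a set \<Rightarrow> bool" where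
  "max_ordered X le B \<longleftrightarrow> B \<subseteq> X \<and>
     (\<forall>C. C \<subseteq> X \<and> card C = card B \<longrightarrow> ord_pairs C le \<le> ord_pairs B le)"

definition smallest_max_ordered :: "'a set \<Rightarrow> ('a \<Rightarrow> 'a \<Rightarrow> bool) \<Rightarrow> 'a set \<Rightarrow> bool" where
  "smallest_max_ordered X le B \<longleftrightarrow> max_ordered X le B \<and> ell B le = ell X le \<and>
     (\<forall>C. max_ordered X le C \<and> ell C le = ell X le \<longrightarrow> card B \<le> card C)"

definition gen_family :: "'a set \<Rightarrow> ('a \<Rightarrow> 'a \<Rightarrow> bool) \<Rightarrow> 'q set \<Rightarrow> ('q \<Rightarrow> 'q \<Rightarrow> bool)
    \<Rightarrow> nat \<Rightarrow> ('a \<Rightarrow> 'a) \<Rightarrow> (nat \<Rightarrow> 'a set) \<Rightarrow> bool" where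
  "gen_family A le QA Qle r \<sigma> S \<longleftrightarrow> poset_aut A le \<sigma> \<and> 2 \<le> r \<and>
     (\<forall>i<r. S i \<subseteq> moved A \<sigma> \<and> order_iso (S i) le QA Qle
        \<and> smallest_max_ordered (moved A \<sigma>) le (S i)
        \<and> \<sigma> ` (S i) = S (Suc i mod r)
        \<and> ell (S i) le = ell (moved A \<sigma>) le)
     \<and> (\<Union>i<r. S i) = moved A \<sigma>"

definition is_generator :: "'a set \<Rightarrow> ('a \<Rightarrow> 'a \<Rightarrow> bool) \<Rightarrow> 'q set \<Rightarrow> ('q \<Rightarrow> 'q \<Rightarrow> bool)
    \<Rightarrow> nat \<Rightarrow> ('a \<Rightarrow> 'a) \<Rightarrow> bool" where
  "is_generator A le QA Qle r \<sigma> \<longleftrightarrow> (\<exists>S. gen_family A le QA Qle r \<sigma> S)"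

definition sym1 :: "'a set \<Rightarrow> ('a \<Rightarrow> 'a \<Rightarrow> bool) \<Rightarrow> 'q set \<Rightarrow> ('q \<Rightarrow> 'q \<Rightarrow> bool)
    \<Rightarrow> nat \<Rightarrow> 'a \<Rightarrow> 'a \<Rightarrow> bool" where
  "sym1 A le QA Qle r a b \<longleftrightarrow> (\<exists>\<sigma> S i j q. gen_family A le QA Qle r \<sigma> S \<and> i < r \<and> j < r
      \<and> S i \<noteq> S j \<and> a \<in> S i \<and> b \<in> S j \<and> 1 \<le> q \<and> q < r \<and> b = (\<sigma> ^^ q) a)"

text \<open>(Q,r)-symmetry: the equivalence relation generated by (Q,r,1)-symmetry (the union over
m of (Q,r,m)-symmetry, which the paper states is an equivalence relation).\<close>
definition qr_sym :: "'a set \<Rightarrow> ('a \<Rightarrow> 'a \<Rightarrow> bool) \<Rightarrow> 'q set \<Rightarrow> ('q \<Rightarrow> 'q \<Rightarrow> bool)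
    \<Rightarrow> nat \<Rightarrow> 'a \<Rightarrow> 'a \<Rightarrow> bool" where
  "qr_sym A le QA Qle r = (sup (sym1 A le QA Qle r) (sym1 A le QA Qle r)\<inverse>\<inverse>)\<^sup>*\<^sup>*"

definition sym_class :: "'a set \<Rightarrow> ('a \<Rightarrow> 'a \<Rightarrow> bool) \<Rightarrow> 'q set \<Rightarrow> ('q \<Rightarrow> 'q \<Rightarrow> bool)
    \<Rightarrow> nat \<Rightarrow> 'a \<Rightarrow> 'a set" where
  "sym_class A le QA Qle r a = {b \<in> A. qr_sym A le QA Qle r a b}"

definition quot_carrier :: "'a set \<Rightarrow> ('a \<Rightarrow> 'a \<Rightarrow> bool) \<Rightarrow> 'q set \<Rightarrow> ('q \<Rightarrow> 'q \<Rightarrow> bool)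
    \<Rightarrow> nat \<Rightarrow> 'a set set" where
  "quot_carrier A le QA Qle r = sym_class A le QA Qle r ` A"

definition quot_le :: "('a \<Rightarrow> 'a \<Rightarrow> bool) \<Rightarrow> 'a set \<Rightarrow> 'a set \<Rightarrow> bool" where
  "quot_le le E F \<longleftrightarrow> (\<exists>e\<in>E. \<exists>f\<in>F. le e f)"

text \<open>Finite posets Q are represented (up to isomorphism) on finite sets of naturals.\<close>
definition locally_symmetric :: "'a set \<Rightarrow> ('a \<Rightarrow> 'a \<Rightarrow> bool) \<Rightarrow> bool" where
  "locally_symmetric A le \<longleftrightarrow> (\<exists>(QA :: nat set) Qle r. finite QA \<and> po_on QA Qle \<and> 2 \<le> r \<and>
     \<not> order_iso (quot_carrier A le QA Qle r) (quot_le le) A le)"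

definition locally_unsymmetric :: "'a set \<Rightarrow> ('a \<Rightarrow> 'a \<Rightarrow> bool) \<Rightarrow> bool" where
  "locally_unsymmetric A le \<longleftrightarrow> \<not> locally_symmetric A le"

definition posets :: "nat \<Rightarrow> (nat \<Rightarrow> nat \<Rightarrow> bool) set" where
  "posets n = {le. po_on {..<n} le \<and> (\<forall>x y. le x y \<longrightarrow> x < n \<and> y < n)}"

definition iso_rel :: "nat \<Rightarrow> ((nat \<Rightarrow> nat \<Rightarrow> bool) \<times> (nat \<Rightarrow> nat \<Rightarrow> bool)) set" where
  "iso_rel n = {(R1, R2). R1 \<in> posets n \<and> R2 \<in> posets n \<and> order_iso {..<n} R1 {..<n} R2}"

text \<open>The chain length l is an integer so that p(n, n-2) makes sense for n < 2.\<close>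
definition p_count :: "nat \<Rightarrow> int \<Rightarrow> nat" where
  "p_count n l = card ({le \<in> posets n. int (ell {..<n} le) = l} // iso_rel n)"

definition u_count :: "nat \<Rightarrow> int \<Rightarrow> nat" where
  "u_count n l = card ({le \<in> posets n. int (ell {..<n} le) = l \<and> locally_unsymmetric {..<n} le}
                        // iso_rel n)"

end

theory Submission
  imports Defs
begin

text \<open>Put \<open>m = n - 2\<close>. A poset with \<open>n\<close> elements and height \<open>m\<close> is a chain of \<open>m\<close> elements together
  with two points, and is described by the intervals of the chain incomparable to these points
  and by the relation between them. Exchanging a point with a chain element brings this
  description into a normal form. The normal form is unique: an isomorphism preserves the rank
  function, so it fixes every element which is alone in its rank, and at most two ranks have more
  than one element. Since the ranks are this small, a nontrivial automorphism exists iff two twins,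
  or two parallel two-element chains, can be exchanged. Either exchange generates a local symmetry,
  so the locally unsymmetric posets are exactly the rigid ones, and both counts become sums over
  normal forms.\<close>

section \<open>Isomorphisms and chains\<close>

text \<open>A poset may have several longest chains, so the chain picked at the start is a choice,
  and the two leftover points depend on it. Ranks do not: as the height is \<open>m\<close>, any
  chain of \<open>m\<close> elements meets each rank below \<open>m\<close> exactly once, and the
  surplus in the rank sizes shows where the leftover points sit. After that only a few
  comparabilities and thresholds have to be compared. The height also restricts the codes: a
  leftover point comparable to the whole chain, or two comparable ones that could together replace a
  single chain element, would produce a chain of \<open>m + 1\<close> elements. A local symmetry
  asks for more than an automorphism, since smallest maximally ordered subsets of full height must
  cover the moved set. Chains satisfy this automatically, because no poset of the same size has more
  comparable pairs. Hence it matters that the symmetries found exchange chains. Only these exchanges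
  are transported along isomorphisms, not the notion of local symmetry itself.\<close>

lemma order_iso_sym:
  assumes "order_iso A le B le'"
  shows "order_iso B le' A le"
proof -
  obtain f where f: "bij_betw f A B" "\<forall>x\<in>A. \<forall>y\<in>A. le x y \<longleftrightarrow> le' (f x) (f y)"
    using assms unfolding order_iso_def by blast
  have "le' x y \<longleftrightarrow> le (inv_into A f x) (inv_into A f y)" if "x \<in> B" "y \<in> B" for x y
    using that f(2) bij_betw_inv_into_right[OF f(1)] bij_betwE[OF bij_betw_inv_into[OF f(1)]]
    by simp
  then show ?thesis
    unfolding order_iso_def using bij_betw_inv_into[OF f(1)] by blast
qed

lemma order_iso_trans:
  assumes "order_iso A le B le'" "order_iso B le' C le''"
  shows "order_iso A le C le''"
proof -
  obtain f where f: "bij_betw f A B" "\<forall>x\<in>A. \<forall>y\<in>A. le x y \<longleftrightarrow> le' (f x) (f y)"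
    using assms unfolding order_iso_def by blast
  obtain g where g: "bij_betw g B C" "\<forall>x\<in>B. \<forall>y\<in>B. le' x y \<longleftrightarrow> le'' (g x) (g y)"
    using assms unfolding order_iso_def by blast
  have "bij_betw (g \<circ> f) A C"
    using f g bij_betw_trans by blast
  moreover have "le x y \<longleftrightarrow> le'' ((g \<circ> f) x) ((g \<circ> f) y)" if "x \<in> A" "y \<in> A" for x y
    using f(2) g(2) that bij_betwE[OF f(1)] by simp
  ultimately show ?thesis
    unfolding order_iso_def by blast
qed

lemma order_iso_refl: "order_iso A le A le"
  unfolding order_iso_def using bij_betw_id by fastforce

lemma po_on_subset: "po_on A le \<Longrightarrow> B \<subseteq> A \<Longrightarrow> po_on B le"
  unfolding po_on_def by (meson subsetD)

lemma card_chain_le_ell: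
  assumes "finite B" "C \<subseteq> B" "is_chain C le"
  shows "card C \<le> ell B le"
  unfolding ell_def using assms by (intro Max_ge) auto

lemma ell_le:
  assumes "finite B" "\<And>C. C \<subseteq> B \<Longrightarrow> is_chain C le \<Longrightarrow> card C \<le> t"
  shows "ell B le \<le> t"
proof -
  have "{} \<in> {C. C \<subseteq> B \<and> is_chain C le}"
    by (simp add: is_chain_def)
  then show ?thesis
    unfolding ell_def using assms by (subst Max_le_iff) auto
qed

lemma ell_witness:
  assumes "finite B"
  obtains C where "C \<subseteq> B" "is_chain C le" "card C = ell B le"
proof -
  have "{} \<in> {C. C \<subseteq> B \<and> is_chain C le}"
    by (simp add: is_chain_def)
  then have "ell B le \<in> card ` {C. C \<subseteq> B \<and> is_chain C le}"
    unfolding ell_def using assms by (intro Max_in) auto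
  then show ?thesis
    using that by auto
qed

lemma ell_le_card: "finite B \<Longrightarrow> ell B le \<le> card B"
  by (rule ell_le) (auto intro: card_mono)

lemma ell_chain: "finite C \<Longrightarrow> is_chain C le \<Longrightarrow> ell C le = card C"
  by (intro antisym ell_le_card card_chain_le_ell) auto

text \<open>The number of elements strictly below is the position in the chain: it increases
  strictly and stays below \<open>card C\<close>, so it is a bijection whose inverse lists the
  chain.\<close>

lemma chain_enumeration:
  assumes "finite C" "po_on C le" "is_chain C le"
  obtains g where "bij_betw g {..<card C} C"
    and "\<And>i j. i < card C \<Longrightarrow> j < card C \<Longrightarrow> le (g i) (g j) \<longleftrightarrow> i \<le> j"
proof -
  define h where "h v = card {w \<in> C. le w v \<and> w \<noteq> v}" for v
  have less: "h v < h w" if "v \<in> C" "w \<in> C" "le v w" "v \<noteq> w" for v w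
  proof -
    have "{u \<in> C. le u v \<and> u \<noteq> v} \<subset> {u \<in> C. le u w \<and> u \<noteq> w}"
      using that assms(2) unfolding po_on_def by blast
    then show ?thesis
      unfolding h_def using assms(1) by (intro psubset_card_mono) auto
  qed
  have le_iff: "le v w \<longleftrightarrow> h v \<le> h w" if "v \<in> C" "w \<in> C" for v w
    using that less[of v w] less[of w v] assms(2,3)
    unfolding po_on_def is_chain_def by (metis leD less_imp_le order_refl)
  have inj: "inj_on h C"
  proof (rule inj_onI)
    fix v w assume vw: "v \<in> C" "w \<in> C" "h v = h w"
    then have "le v w" "le w v"
      by (simp_all add: le_iff)
    then show "v = w"
      using vw assms(2) unfolding po_on_def by blast
  qed
  have "h v < card C" if "v \<in> C" for v
    unfolding h_def using assms(1) that by (intro psubset_card_mono) auto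
  then have "h ` C = {..<card C}"
    using inj by (intro card_subset_eq) (auto simp: card_image)
  then have bij: "bij_betw h C {..<card C}"
    using inj by (simp add: bij_betw_def)
  show ?thesis
  proof (rule that)
    show "bij_betw (inv_into C h) {..<card C} C"
      using bij by (rule bij_betw_inv_into)
    show "le (inv_into C h i) (inv_into C h j) \<longleftrightarrow> i \<le> j" if "i < card C" "j < card C" for i j
      using that bij le_iff
      by (metis bij_betw_imp_surj_on f_inv_into_f inv_into_into lessThan_iff)
  qed
qed

section \<open>Local symmetry and automorphisms\<close>

definition rigid :: "'a set \<Rightarrow> ('a \<Rightarrow> 'a \<Rightarrow> bool) \<Rightarrow> bool" where
  "rigid A le \<longleftrightarrow> (\<forall>\<sigma>. poset_aut A le \<sigma> \<longrightarrow> (\<forall>a\<in>A. \<sigma> a = a))"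

text \<open>Without moved points all members of a generator family are empty, hence equal, so
  \<open>sym1\<close> never holds. All classes are singletons and the quotient is a copy of
  \<open>A\<close>, whatever \<open>QA\<close> and \<open>r\<close> are.\<close>

lemma rigid_imp_locally_unsymmetric:
  assumes "rigid A le"
  shows "locally_unsymmetric A le"
proof -
  have "order_iso (quot_carrier A le QA Qle r) (quot_le le) A le"
    for QA :: "nat set" and Qle r
  proof -
    have "\<not> sym1 A le QA Qle r a b" for a b
    proof
      assume "sym1 A le QA Qle r a b"
      then obtain \<sigma> S i j where g: "gen_family A le QA Qle r \<sigma> S" "i < r" "j < r" "S i \<noteq> S j"
        unfolding sym1_def by blast
      then have "poset_aut A le \<sigma>"
        unfolding gen_family_def by blast
      then have "moved A \<sigma> = {}"
        using assms unfolding rigid_def moved_def by blast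
      then have "S i = {}" "S j = {}"
        using g unfolding gen_family_def by blast+
      then show False
        using g by simp
    qed
    then have "sym1 A le QA Qle r = bot"
      by (intro ext) simp
    then have "qr_sym A le QA Qle r = (=)"
      by (auto simp: qr_sym_def fun_eq_iff sup_fun_def elim: rtranclp_induct)
    then have cls: "sym_class A le QA Qle r a = {a}" if "a \<in> A" for a
      using that by (auto simp: sym_class_def)
    then have carrier: "quot_carrier A le QA Qle r = (\<lambda>a. {a}) ` A"
      unfolding quot_carrier_def by (intro image_cong) auto
    have "order_iso A le ((\<lambda>a. {a}) ` A) (quot_le le)"
      unfolding order_iso_def
      by (intro exI[of _ "\<lambda>a. {a}"]) (auto simp: quot_le_def bij_betw_def inj_on_def)
    then show ?thesis
      using carrier order_iso_sym by metis
  qed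
  then show ?thesis
    unfolding locally_unsymmetric_def locally_symmetric_def by blast
qed

text \<open>Tailored to be a generator with \<open>r = 2\<close> and a chain in the role of Q. A
  singleton \<open>T\<close> is an exchange of twins, a two-element \<open>T\<close> an exchange of
  parallel two-element chains.\<close>

definition swaps_parallel_chains :: "'a set \<Rightarrow> ('a \<Rightarrow> 'a \<Rightarrow> bool) \<Rightarrow> ('a \<Rightarrow> 'a) \<Rightarrow> 'a set \<Rightarrow> bool" where
  "swaps_parallel_chains A le \<sigma> T \<longleftrightarrow> poset_aut A le \<sigma> \<and> T \<noteq> {} \<and> moved A \<sigma> = T \<union> \<sigma> ` T \<and>
     T \<inter> \<sigma> ` T = {} \<and> (\<forall>a\<in>T. \<sigma> (\<sigma> a) = a) \<and> is_chain T le \<and>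
     (\<forall>a\<in>T. \<forall>b\<in>T. \<not> le a (\<sigma> b) \<and> \<not> le (\<sigma> b) a)"

text \<open>By antisymmetry a pair is strictly ordered in one direction at most, so
  \<open>ord_pairs\<close> counts certain two-element subsets.\<close>

lemma ord_pairs_inj:
  assumes "po_on B le"
  shows "inj_on (\<lambda>(a, b). {a, b}) {(a, b). a \<in> B \<and> b \<in> B \<and> le a b \<and> a \<noteq> b}"
proof (rule inj_onI, clarify)
  fix a b c d
  assume "a \<in> B" "b \<in> B" "le a b" "a \<noteq> b" "le c d" "{a, b} = {c, d}"
  moreover have "\<not> le b a"
    using calculation assms unfolding po_on_def by blast
  ultimately show "a = c \<and> b = d"
    unfolding doubleton_eq_iff by blast
qed

lemma ord_pairs_le_choose:
  assumes "finite B" "po_on B le"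
  shows "ord_pairs B le \<le> card B choose 2"
proof -
  have "ord_pairs B le \<le> card {D. D \<subseteq> B \<and> card D = 2}"
    unfolding ord_pairs_def using assms
    by (intro card_inj_on_le[OF ord_pairs_inj]) auto
  then show ?thesis
    using assms n_subsets by metis
qed

lemma ord_pairs_chain:
  assumes "finite B" "po_on B le" "is_chain B le"
  shows "ord_pairs B le = card B choose 2"
proof -
  have "(\<lambda>(a, b). {a, b}) ` {(a, b). a \<in> B \<and> b \<in> B \<and> le a b \<and> a \<noteq> b} = {D. D \<subseteq> B \<and> card D = 2}"
  proof (intro equalityI subsetI)
    fix D assume "D \<in> {D. D \<subseteq> B \<and> card D = 2}"
    then obtain a b where ab: "D = {a, b}" "a \<noteq> b" "a \<in> B" "b \<in> B"
      by (auto simp: card_2_iff)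
    then consider "le a b" | "le b a"
      using assms(3) unfolding is_chain_def by blast
    then show "D \<in> (\<lambda>(a, b). {a, b}) ` {(a, b). a \<in> B \<and> b \<in> B \<and> le a b \<and> a \<noteq> b}"
      by cases (use ab in \<open>auto simp: image_iff doubleton_eq_iff\<close>)
  qed auto
  then have "ord_pairs B le = card {D. D \<subseteq> B \<and> card D = 2}"
    unfolding ord_pairs_def using card_image[OF ord_pairs_inj[OF assms(2)]] by simp
  then show ?thesis
    using assms n_subsets by metis
qed

text \<open>A chain attains the bound \<open>card C choose 2\<close>, so it is maximally ordered;
  and a set of height \<open>card C\<close> cannot have fewer elements.\<close>

lemma smallest_max_ordered_chain:
  assumes "finite X" "po_on X le" "C \<subseteq> X" "is_chain C le" "ell X le = card C"
  shows "smallest_max_ordered X le C"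
proof -
  have fin: "finite D" if "D \<subseteq> X" for D
    using assms(1) that finite_subset by blast
  have "ord_pairs D le \<le> ord_pairs C le" if "D \<subseteq> X" "card D = card C" for D
    using ord_pairs_le_choose[of D le] ord_pairs_chain[of C le] assms fin that po_on_subset by metis
  moreover have "card C \<le> card D" if "D \<subseteq> X" "ell D le = ell X le" for D
    using ell_le_card[of D le] assms fin that by metis
  ultimately show ?thesis
    using assms fin ell_chain[of C le]
    unfolding smallest_max_ordered_def max_ordered_def by auto
qed

lemma order_iso_chain:
  assumes "finite C" "po_on C le" "is_chain C le"
  shows "order_iso C le {..<card C} (\<le>)"
proof -
  obtain g where "bij_betw g {..<card C} C"
    "\<And>i j. i < card C \<Longrightarrow> j < card C \<Longrightarrow> le (g i) (g j) \<longleftrightarrow> i \<le> j"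
    using chain_enumeration[OF assms] by blast
  then have "order_iso {..<card C} (\<le>) C le"
    unfolding order_iso_def by (intro exI[of _ g]) auto
  then show ?thesis
    by (rule order_iso_sym)
qed

lemma swaps_parallel_chains_imp_sym1:
  assumes "finite A" "po_on A le" "swaps_parallel_chains A le \<sigma> T" "a \<in> T"
  shows "sym1 A le {..<card T} (\<le>) 2 a (\<sigma> a)"
proof -
  let ?T' = "\<sigma> ` T"
  have \<sigma>: "poset_aut A le \<sigma>" and moved: "moved A \<sigma> = T \<union> ?T'" and disj: "T \<inter> ?T' = {}"
    and inv: "\<forall>a\<in>T. \<sigma> (\<sigma> a) = a" and chain: "is_chain T le"
    and par: "\<forall>a\<in>T. \<forall>b\<in>T. \<not> le a (\<sigma> b) \<and> \<not> le (\<sigma> b) a"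
    using assms(3) unfolding swaps_parallel_chains_def by blast+
  have sub: "T \<union> ?T' \<subseteq> A"
    using moved unfolding moved_def by blast
  have T'T: "\<sigma> ` ?T' = T"
    using inv by force
  have chain': "is_chain ?T' le"
    using chain \<sigma> sub unfolding is_chain_def poset_aut_def by (simp add: subset_iff)
  have "inj_on \<sigma> T"
    using inv by (metis inj_on_inverseI)
  then have card': "card ?T' = card T"
    by (rule card_image)
  have fin: "finite (T \<union> ?T')"
    using assms(1) sub finite_subset by blast
  have po: "po_on (T \<union> ?T') le"
    using assms(2) sub po_on_subset by blast
  \<comment> \<open>The halves are mutually incomparable, so a chain in their union stays inside one
    of them.\<close>
  have "card C \<le> card T" if C: "C \<subseteq> T \<union> ?T'" "is_chain C le" for C
  proof -
    have "C \<subseteq> T \<or> C \<subseteq> ?T'"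
    proof (rule ccontr)
      assume "\<not> (C \<subseteq> T \<or> C \<subseteq> ?T')"
      then obtain b c where "b \<in> C" "c \<in> C" "b \<in> T" "c \<in> ?T'"
        using C(1) by blast
      then show False
        using C(2) par unfolding is_chain_def by blast
    qed
    then show ?thesis
      using fin card' by (metis card_mono finite_Un)
  qed
  then have ell: "ell (T \<union> ?T') le = card T"
    using fin chain by (intro antisym ell_le card_chain_le_ell) auto
  have ok: "smallest_max_ordered (T \<union> ?T') le T" "smallest_max_ordered (T \<union> ?T') le ?T'"
    using smallest_max_ordered_chain[OF fin po] chain chain' card' ell by auto
  have iso: "order_iso T le {..<card T} (\<le>)" "order_iso ?T' le {..<card T} (\<le>)"
    using order_iso_chain[of T le] order_iso_chain[of ?T' le] chain chain' card' fin po
      po_on_subset[of "T \<union> ?T'" le] by auto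
  have ells: "ell T le = card T" "ell ?T' le = card T"
    using ell_chain[of T le] ell_chain[of ?T' le] fin chain chain' card' by auto
  let ?S = "\<lambda>i::nat. if i = 0 then T else ?T'"
  have gen: "gen_family A le {..<card T} (\<le>) 2 \<sigma> ?S"
    unfolding gen_family_def moved
    using \<sigma> ok iso ells ell T'T by (auto simp: less_2_cases_iff)
  have "T \<noteq> ?T'"
    using assms(4) disj by blast
  then show ?thesis
    unfolding sym1_def using gen assms(4)
    by (intro exI[of _ \<sigma>] exI[of _ ?S] exI[of _ 0] exI[of _ 1]) auto
qed

text \<open>Since \<open>a\<close> and \<open>b\<close> share a class, the quotient has fewer
  elements than the finite set \<open>A\<close>.\<close>

lemma sym1_imp_locally_symmetric:
  fixes QA :: "nat set"
  assumes "finite A" "finite QA" "po_on QA Qle" "2 \<le> r"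
    and "sym1 A le QA Qle r a b" "a \<in> A" "b \<in> A" "a \<noteq> b"
  shows "locally_symmetric A le"
proof -
  let ?R = "sup (sym1 A le QA Qle r) (sym1 A le QA Qle r)\<inverse>\<inverse>"
  have "symp ?R"
    by (auto simp: symp_def)
  then have sym: "symp ?R\<^sup>*\<^sup>*"
    by (rule symp_rtranclp)
  have ab: "qr_sym A le QA Qle r a b"
    using assms(5) unfolding qr_sym_def by blast
  then have "qr_sym A le QA Qle r a c \<longleftrightarrow> qr_sym A le QA Qle r b c" for c
    using rtranclp_trans[of ?R] sympD[OF sym, of a b] unfolding qr_sym_def by blast
  then have eq: "sym_class A le QA Qle r a = sym_class A le QA Qle r b"
    unfolding sym_class_def by blast
  have "\<not> order_iso (quot_carrier A le QA Qle r) (quot_le le) A le"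
  proof
    assume "order_iso (quot_carrier A le QA Qle r) (quot_le le) A le"
    then have "card (sym_class A le QA Qle r ` A) = card A"
      unfolding order_iso_def quot_carrier_def using bij_betw_same_card by blast
    then have "inj_on (sym_class A le QA Qle r) A"
      using assms(1) eq_card_imp_inj_on by blast
    then show False
      using eq assms inj_onD by metis
  qed
  then show ?thesis
    unfolding locally_symmetric_def using assms by blast
qed

lemma swaps_parallel_chains_imp_locally_symmetric:
  assumes "finite A" "po_on A le" "swaps_parallel_chains A le \<sigma> T"
  shows "locally_symmetric A le"
proof -
  obtain a where a: "a \<in> T"
    using assms(3) unfolding swaps_parallel_chains_def by blast
  have "a \<in> moved A \<sigma>"
    using a assms(3) unfolding swaps_parallel_chains_def by blast
  then have "a \<in> A" "\<sigma> a \<noteq> a"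
    unfolding moved_def by auto
  moreover have "\<sigma> a \<in> A"
    using \<open>a \<in> A\<close> assms(3) unfolding swaps_parallel_chains_def poset_aut_def by (auto dest: bij_betwE)
  ultimately show ?thesis
    using sym1_imp_locally_symmetric[OF assms(1) _ _ _ swaps_parallel_chains_imp_sym1[OF assms a]]
    by (auto simp: po_on_def)
qed

text \<open>Conjugation by the isomorphism carries the exchange over, so a symmetry found on a
  normal form is available on every isomorphic poset.\<close>

lemma swaps_parallel_chains_iso:
  assumes "order_iso A le B le'" "swaps_parallel_chains A le \<sigma> T"
  shows "\<exists>\<tau> U. swaps_parallel_chains B le' \<tau> U"
proof -
  obtain f where f: "bij_betw f A B" and le: "\<And>x y. x \<in> A \<Longrightarrow> y \<in> A \<Longrightarrow> le' (f x) (f y) \<longleftrightarrow> le x y"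
    using assms(1) unfolding order_iso_def by blast
  define g where "g = inv_into A f"
  have gf: "g (f x) = x" if "x \<in> A" for x
    using f that by (simp add: g_def bij_betw_inv_into_left)
  have B: "B = f ` A" and inj: "inj_on f A"
    using f by (auto simp: bij_betw_def)
  have g: "bij_betw g B A"
    unfolding g_def using f by (rule bij_betw_inv_into)
  have \<sigma>: "bij_betw \<sigma> A A" "\<And>x y. x \<in> A \<Longrightarrow> y \<in> A \<Longrightarrow> le x y \<longleftrightarrow> le (\<sigma> x) (\<sigma> y)"
    and moved: "moved A \<sigma> = T \<union> \<sigma> ` T" and disj: "T \<inter> \<sigma> ` T = {}"
    and inv: "\<forall>a\<in>T. \<sigma> (\<sigma> a) = a" and chain: "is_chain T le" and ne: "T \<noteq> {}"
    and par: "\<forall>a\<in>T. \<forall>b\<in>T. \<not> le a (\<sigma> b) \<and> \<not> le (\<sigma> b) a"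
    using assms(2) unfolding swaps_parallel_chains_def poset_aut_def by blast+
  have TA: "T \<union> \<sigma> ` T \<subseteq> A"
    using moved unfolding moved_def by blast
  have \<sigma>A: "\<sigma> x \<in> A" if "x \<in> A" for x
    using \<sigma>(1) that by (auto dest: bij_betwE)
  define \<tau> where "\<tau> = f \<circ> \<sigma> \<circ> g"
  have \<tau>f: "\<tau> (f x) = f (\<sigma> x)" if "x \<in> A" for x
    using that by (simp add: \<tau>_def gf)
  have f_eq: "f x = f y \<longleftrightarrow> x = y" if "x \<in> A" "y \<in> A" for x y
    using inj that by (auto dest: inj_onD)
  have T: "x \<in> A" "\<sigma> x \<in> A" if "x \<in> T" for x
    using TA that by auto
  have img: "\<tau> ` f ` T = f ` \<sigma> ` T"
    using T by (auto simp: \<tau>f image_iff)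
  have "bij_betw \<tau> B B"
    unfolding \<tau>_def using f g \<sigma>(1) by (intro bij_betw_trans)
  moreover have "le' u v \<longleftrightarrow> le' (\<tau> u) (\<tau> v)" if uv: "u \<in> B" "v \<in> B" for u v
  proof -
    obtain x y where "x \<in> A" "y \<in> A" "u = f x" "v = f y"
      using uv unfolding B by blast
    then show ?thesis
      by (simp add: \<tau>f le \<sigma>A flip: \<sigma>(2))
  qed
  ultimately have "poset_aut B le' \<tau>"
    unfolding poset_aut_def by blast
  moreover have "moved B \<tau> = f ` moved A \<sigma>"
    unfolding moved_def B by (auto simp: \<tau>f f_eq \<sigma>A)
  then have "moved B \<tau> = f ` T \<union> \<tau> ` f ` T"
    unfolding moved img by (simp add: image_Un)
  moreover have "f ` T \<inter> \<tau> ` f ` T = {}"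
    unfolding img using disj inj TA by (metis image_empty inj_on_image_Int le_sup_iff)
  moreover have "\<forall>a\<in>f ` T. \<tau> (\<tau> a) = a"
    using inv T by (simp add: \<tau>f)
  moreover have "is_chain (f ` T) le'"
    using chain T unfolding is_chain_def by (simp add: le)
  moreover have "\<forall>a\<in>f ` T. \<forall>b\<in>f ` T. \<not> le' a (\<tau> b) \<and> \<not> le' (\<tau> b) a"
    using par T by (simp add: \<tau>f le)
  ultimately have "swaps_parallel_chains B le' \<tau> (f ` T)"
    unfolding swaps_parallel_chains_def using ne by blast
  then show ?thesis
    by blast
qed

section \<open>Rank functions\<close>

text \<open>In a finite poset this is the height function, the length of a longest strict descent
  from an element. Two local conditions replace the maximum and can be checked directly on an
  explicit relation.\<close>

definition rank_fun :: "'a set \<Rightarrow> ('a \<Rightarrow> 'a \<Rightarrow> bool) \<Rightarrow> ('a \<Rightarrow> nat) \<Rightarrow> bool" where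
  "rank_fun A le h \<longleftrightarrow> (\<forall>v\<in>A. \<forall>w\<in>A. le v w \<and> v \<noteq> w \<longrightarrow> h v < h w) \<and>
     (\<forall>w\<in>A. \<forall>i. h w = Suc i \<longrightarrow> (\<exists>v\<in>A. le v w \<and> h v = i))"

text \<open>The second condition on \<open>h\<close> gives a descent of \<open>h w\<close> strict
  steps from \<open>w\<close>, each of which lowers \<open>h'\<close> by at least one.\<close>

lemma rank_fun_le:
  assumes "rank_fun A le h" "rank_fun A le h'" "w \<in> A"
  shows "h w \<le> h' w"
  using assms(3)
proof (induction "h w" arbitrary: w)
  case (Suc i)
  then obtain v where v: "v \<in> A" "le v w" "h v = i"
    using assms(1) unfolding rank_fun_def by metis
  then have "h v \<le> h' v" "v \<noteq> w"
    using Suc by auto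
  moreover have "h' v < h' w"
    using v Suc.prems \<open>v \<noteq> w\<close> assms(2) unfolding rank_fun_def by blast
  ultimately show ?case
    using Suc.hyps(2) v(3) by linarith
qed simp

lemma rank_fun_unique:
  assumes "rank_fun A le h" "rank_fun A le h'" "w \<in> A"
  shows "h w = h' w"
  using rank_fun_le[OF assms] rank_fun_le[OF assms(2,1,3)] by simp

text \<open>Together with uniqueness this shows that isomorphisms preserve ranks.\<close>

lemma rank_fun_comp:
  assumes "rank_fun B le' h" "bij_betw f A B"
    and "\<And>x y. x \<in> A \<Longrightarrow> y \<in> A \<Longrightarrow> le x y \<longleftrightarrow> le' (f x) (f y)"
  shows "rank_fun A le (h \<circ> f)"
proof -
  have B: "B = f ` A" and inj: "inj_on f A"
    using assms(2) by (auto simp: bij_betw_def)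
  show ?thesis
    unfolding rank_fun_def
  proof (intro conjI ballI allI impI)
    fix v w assume vw: "v \<in> A" "w \<in> A" "le v w \<and> v \<noteq> w"
    then have "f v \<noteq> f w" "le' (f v) (f w)"
      using inj assms(3) by (auto dest: inj_onD)
    then show "(h \<circ> f) v < (h \<circ> f) w"
      using vw assms(1) B unfolding rank_fun_def by auto
  next
    fix w i assume w: "w \<in> A" "(h \<circ> f) w = Suc i"
    then obtain v where "v \<in> B" "le' v (f w)" "h v = i"
      using assms(1) B unfolding rank_fun_def comp_def by blast
    then show "\<exists>v\<in>A. le v w \<and> (h \<circ> f) v = i"
      using B w assms(3) by auto
  qed
qed

lemma ell_le_rank:
  assumes "finite A" "rank_fun A le h" "\<And>v. v \<in> A \<Longrightarrow> h v < t"
  shows "ell A le \<le> t"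
proof (rule ell_le[OF assms(1)])
  fix C assume C: "C \<subseteq> A" "is_chain C le"
  have "inj_on h C"
  proof (rule inj_onI, rule ccontr)
    fix v w assume vw: "v \<in> C" "w \<in> C" "h v = h w" "v \<noteq> w"
    then have "le v w \<or> le w v"
      using C(2) unfolding is_chain_def by blast
    then have "h v < h w \<or> h w < h v"
      using vw C(1) assms(2) unfolding rank_fun_def by blast
    then show False
      using vw by simp
  qed
  then have "card C = card (h ` C)"
    by (simp add: card_image)
  also have "\<dots> \<le> card {..<t}"
    using C(1) assms(3) by (intro card_mono) auto
  finally show "card C \<le> t"
    by simp
qed

section \<open>Chains extended by two points\<close>

text \<open>The chain \<open>0 < \<dots> < m - 1\<close> together with the points \<open>m\<close> and \<open>m + 1\<close>: the point \<open>m\<close> lies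
  above the chain elements \<open>i < k\<close> and below those with \<open>i \<ge> x\<close>, the point \<open>m + 1\<close> lies above
  the \<open>i < l\<close> and below the \<open>i \<ge> y\<close>, and \<open>M\<close> tells whether \<open>m\<close> is below \<open>m + 1\<close>.\<close>
definition chain_ext :: "nat \<Rightarrow> nat \<Rightarrow> nat \<Rightarrow> nat \<Rightarrow> nat \<Rightarrow> bool \<Rightarrow> nat \<Rightarrow> nat \<Rightarrow> bool" where
  "chain_ext m k l x y M u v \<longleftrightarrow> u < m + 2 \<and> v < m + 2 \<and>
     (u = v \<or> u < v \<and> v < m \<or> u < k \<and> u < m \<and> v = m \<or> u < l \<and> u < m \<and> v = Suc m \<or>
      u = m \<and> x \<le> v \<and> v < m \<or> u = Suc m \<and> y \<le> v \<and> v < m \<or> u = m \<and> v = Suc m \<and> M)"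

text \<open>If \<open>k = l\<close> and \<open>M\<close>, the point \<open>m + 1\<close> has rank \<open>k + 1\<close> although it is not above the chain
  element \<open>k\<close>. The conditions \<open>k + 2 \<le> x\<close> and \<open>\<not> (x = l + 1 \<and> y = l + 1)\<close> remove duplicates: if \<open>k = l\<close> and \<open>x = k + 1\<close>,
  exchanging \<open>m\<close> with \<open>k\<close> gives data with \<open>l = x = k + 1\<close> and \<open>\<not> M\<close>, and if \<open>x = y = l + 1\<close>,
  exchanging \<open>m + 1\<close> with \<open>l\<close> gives data with \<open>x = l\<close> and \<open>\<not> M\<close>.\<close>
definition canonical :: "nat \<Rightarrow> nat \<Rightarrow> nat \<Rightarrow> nat \<Rightarrow> nat \<Rightarrow> bool \<Rightarrow> bool" where
  "canonical m k l x y M \<longleftrightarrow> k \<le> l \<and> l < m \<and> k < x \<and> x \<le> m \<and> l < y \<and> y \<le> m \<and>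
     (k = l \<longrightarrow> x \<le> y \<and> (M \<longrightarrow> k + 2 \<le> x)) \<and>
     (k < l \<longrightarrow> (if M then x \<le> y \<and> \<not> (x = l + 1 \<and> y = l + 1) else l \<le> x))"

text \<open>For canonical data. If \<open>k = l\<close> without \<open>M\<close>, the elements
  \<open>k\<close>, \<open>m\<close>, \<open>m + 1\<close> share a rank and have upper thresholds
  \<open>k + 1\<close>, \<open>x\<close>, \<open>y\<close>, which must differ. If
  \<open>k = l\<close> with \<open>M\<close>, the only possible symmetry exchanges
  \<open>k < k + 1\<close> with \<open>m < m + 1\<close>, at \<open>x = y = k + 2\<close>. If
  \<open>k < l\<close>, twins \<open>k\<close>, \<open>m\<close> and twins \<open>l\<close>,
  \<open>m + 1\<close> are excluded; without \<open>M\<close> the former cannot occur, as only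
  \<open>k\<close> is below \<open>m + 1\<close>.\<close>

definition rigid_code :: "nat \<Rightarrow> nat \<Rightarrow> nat \<Rightarrow> nat \<Rightarrow> bool \<Rightarrow> bool" where
  "rigid_code k l x y M \<longleftrightarrow>
     (if k = l then if M then k + 2 < y else k + 1 < x \<and> x < y
      else if M then k + 1 < x \<and> l + 1 < y else x = l \<or> l + 1 < y)"

definition code_rank :: "nat \<Rightarrow> nat \<Rightarrow> nat \<Rightarrow> bool \<Rightarrow> nat \<Rightarrow> nat" where
  "code_rank m k l M v =
     (if v < m then v else if v = m then k else if k = l \<and> M then Suc k else l)"

lemma rank_fun_chain_ext:
  assumes "canonical m k l x y M"
  shows "rank_fun {..<m + 2} (chain_ext m k l x y M) (code_rank m k l M)"
  unfolding rank_fun_def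
proof (intro conjI ballI allI impI)
  fix v w
  assume "v \<in> {..<m + 2}" "w \<in> {..<m + 2}" "chain_ext m k l x y M v w \<and> v \<noteq> w"
  then show "code_rank m k l M v < code_rank m k l M w"
    using assms unfolding chain_ext_def code_rank_def canonical_def by (auto split: if_splits)
next
  fix w i
  assume w: "w \<in> {..<m + 2}" "code_rank m k l M w = Suc i"
  show "\<exists>v\<in>{..<m + 2}. chain_ext m k l x y M v w \<and> code_rank m k l M v = i"
  \<comment> \<open>Only here must the predecessor be the point \<open>m\<close>; otherwise the
    chain element \<open>i\<close> serves.\<close>
  proof (cases "w = Suc m \<and> k = l \<and> M")
    case True
    then show ?thesis
      using w by (intro bexI[of _ m]) (auto simp: chain_ext_def code_rank_def)
  next
    case False
    then show ?thesis
      using w assms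
      by (intro bexI[of _ i]) (auto simp: chain_ext_def code_rank_def canonical_def split: if_splits)
  qed
qed

lemma chain_ext_in_posets:
  assumes "canonical m k l x y M"
  shows "chain_ext m k l x y M \<in> posets (m + 2)"
proof -
  let ?R = "chain_ext m k l x y M"
  \<comment> \<open>The inequalities behind transitivity. The last one keeps chain elements from
    lying between \<open>m\<close> and \<open>m + 1\<close>, which would force
    \<open>M\<close>.\<close>
  have c: "k \<le> l" "k < x" "l < y" "M \<longrightarrow> x \<le> y" "\<not> M \<longrightarrow> l \<le> x"
    using assms unfolding canonical_def by (auto split: if_splits)
  show ?thesis
    unfolding posets_def po_on_def
  proof (intro CollectI conjI ballI allI impI)
    fix u v w
    assume "?R u v \<and> ?R v w"
    then have uv: "?R u v" and vw: "?R v w"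
      by auto
    have "v < m + 2"
      using uv unfolding chain_ext_def by auto
    then consider "v < m" | "v = m" | "v = Suc m"
      by linarith
    then show "?R u w"
    proof cases
      case 1
      then have "u \<le> v \<or> u = m \<and> x \<le> v \<or> u = Suc m \<and> y \<le> v"
        and "v \<le> w \<and> w < m \<or> w = m \<and> v < k \<or> w = Suc m \<and> v < l"
        using uv vw by (auto simp: chain_ext_def)
      then show ?thesis
        using 1 c by (elim disjE conjE) (auto simp: chain_ext_def)
    next
      case 2
      then have "u = m \<or> u < k \<and> u < m" and "w = m \<or> x \<le> w \<and> w < m \<or> w = Suc m \<and> M"
        using uv vw by (auto simp: chain_ext_def)
      then show ?thesis
        using c by (elim disjE conjE) (auto simp: chain_ext_def)
    next
      case 3
      then have "u = Suc m \<or> u < l \<and> u < m \<or> u = m \<and> M" and "w = Suc m \<or> y \<le> w \<and> w < m"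
        using uv vw by (auto simp: chain_ext_def)
      then show ?thesis
        using c by (elim disjE conjE) (auto simp: chain_ext_def)
    qed
  next
    fix u v
    assume "u \<in> {..<m + 2}" "v \<in> {..<m + 2}" "?R u v \<and> ?R v u"
    then show "u = v"
      using rank_fun_chain_ext[OF assms] unfolding rank_fun_def by (metis less_asym)
  qed (auto simp: chain_ext_def)
qed

text \<open>All ranks are below \<open>m\<close>; for the rank \<open>k + 1\<close> of the point
  \<open>m + 1\<close> when \<open>k = l\<close> and \<open>M\<close>, this is due to
  \<open>k + 2 \<le> x \<le> m\<close>.\<close>

lemma ell_chain_ext:
  assumes "canonical m k l x y M"
  shows "ell {..<m + 2} (chain_ext m k l x y M) = m"
proof (rule antisym)
  show "ell {..<m + 2} (chain_ext m k l x y M) \<le> m"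
    using assms
    by (intro ell_le_rank[OF _ rank_fun_chain_ext]) (auto simp: code_rank_def canonical_def)
  have "is_chain {..<m} (chain_ext m k l x y M)"
    by (auto simp: is_chain_def chain_ext_def)
  then have "card {..<m} \<le> ell {..<m + 2} (chain_ext m k l x y M)"
    by (intro card_chain_le_ell) auto
  then show "m \<le> ell {..<m + 2} (chain_ext m k l x y M)"
    by simp
qed

section \<open>Uniqueness of the normal form\<close>

lemma card_code_rank_level:
  assumes "i < m"
  shows "card {v \<in> {..<m + 2}. code_rank m k l M v = i} =
    1 + (if k = i then 1 else 0) + (if code_rank m k l M (Suc m) = i then 1 else 0)"
proof -
  have "{v \<in> {..<m + 2}. code_rank m k l M v = i} =
    {i} \<union> (if k = i then {m} else {}) \<union> (if code_rank m k l M (Suc m) = i then {Suc m} else {})"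
    using assms by (auto simp: code_rank_def less_Suc_eq split: if_splits)
  then show ?thesis
    using assms by simp
qed

text \<open>Comparisons with chain elements test a threshold only at \<open>j < m\<close>; the value
  \<open>m\<close> means that no test succeeds.\<close>

lemma threshold_eq:
  fixes a b m :: nat
  assumes "a \<le> m" "b \<le> m" "\<And>j. k < j \<Longrightarrow> j < m \<Longrightarrow> a \<le> j \<longleftrightarrow> b \<le> j" "k < a" "k < b"
  shows "a = b"
  using assms(1,2,4,5) assms(3)[of a] assms(3)[of b] by (cases "a < m"; cases "b < m") auto

text \<open>The isomorphism permutes each rank. If both extra points have rank \<open>k\<close>,
  three upper thresholds are matched up; otherwise two ranks of two elements each are kept or
  swapped, giving four cases. Rigidity is obtained along the way, by taking both codes
  equal.\<close>

lemma chain_ext_iso_unique: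
  assumes c: "canonical m k l x y M" and c': "canonical m k' l' x' y' M'"
    and bij: "bij_betw f {..<m + 2} {..<m + 2}"
    and iso: "\<And>u v. u < m + 2 \<Longrightarrow> v < m + 2 \<Longrightarrow>
      chain_ext m k l x y M u v \<longleftrightarrow> chain_ext m k' l' x' y' M' (f u) (f v)"
  shows "(k, l, x, y, M) = (k', l', x', y', M') \<and>
    (rigid_code k l x y M \<longrightarrow> (\<forall>u<m + 2. f u = u))"
proof -
  let ?R = "chain_ext m k l x y M" and ?R' = "chain_ext m k' l' x' y' M'"
  let ?h = "code_rank m k l M" and ?h' = "code_rank m k' l' M'"
  define s s' where "s = ?h (Suc m)" and "s' = ?h' (Suc m)"
  have fin: "f v < m + 2" if "v < m + 2" for v
    using bij_betwE[OF bij] that by simp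
  have inj: "f u = f v \<longleftrightarrow> u = v" if "u < m + 2" "v < m + 2" for u v
    using bij that by (auto simp: bij_betw_def dest: inj_onD)
  have "rank_fun {..<m + 2} ?R (?h' \<circ> f)"
    by (rule rank_fun_comp[OF rank_fun_chain_ext[OF c'] bij]) (use iso in simp)
  then have hf: "?h' (f v) = ?h v" if "v < m + 2" for v
    using rank_fun_unique[OF rank_fun_chain_ext[OF c], of "?h' \<circ> f" v] that by simp
  have "bij_betw f {v \<in> {..<m + 2}. ?h v = i} {v \<in> {..<m + 2}. ?h' v = i}" for i
    unfolding bij_betw_def
  proof
    show "inj_on f {v \<in> {..<m + 2}. ?h v = i}"
      using inj by (intro inj_onI) auto
    show "f ` {v \<in> {..<m + 2}. ?h v = i} = {v \<in> {..<m + 2}. ?h' v = i}"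
    proof (intro equalityI subsetI)
      fix w assume w: "w \<in> {v \<in> {..<m + 2}. ?h' v = i}"
      then obtain v where "v < m + 2" "w = f v"
        using bij unfolding bij_betw_def by blast
      then show "w \<in> f ` {v \<in> {..<m + 2}. ?h v = i}"
        using w hf by auto
    qed (use hf fin in auto)
  qed
  then have "card {v \<in> {..<m + 2}. ?h v = i} = card {v \<in> {..<m + 2}. ?h' v = i}" for i
    using bij_betw_same_card by blast
  \<comment> \<open>The surplus over the one chain element in each rank determines \<open>k\<close>
    and \<open>s\<close> with multiplicity.\<close>
  then have "(if k = i then 1 else 0::nat) + (if s = i then 1 else 0) =
      (if k' = i then 1 else 0) + (if s' = i then 1 else 0)" if "i < m" for i
    using card_code_rank_level[OF that, of k l M] card_code_rank_level[OF that, of k' l' M']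
    unfolding s_def s'_def by simp
  note levels = this
  have ks: "k < m" "k \<le> s" "s < m" "k' < m" "k' \<le> s'" "s' < m"
    using c c' unfolding s_def s'_def code_rank_def canonical_def by auto
  have kk: "k = k'"
    using levels[of k] levels[of k'] ks by (cases k k' rule: linorder_cases) auto
  then have "s = s'"
    using levels[of s] levels[of s'] ks by (cases s s' rule: linorder_cases) auto
  note kk = kk this
  have f_cases: "f v < m \<and> f v = ?h v \<or> f v = m \<and> ?h v = k \<or> f v = Suc m \<and> ?h v = s"
    if "v < m + 2" for v
    using hf[OF that] fin[OF that] kk unfolding s'_def
    by (cases "f v < m"; cases "f v = m") (auto simp: code_rank_def less_Suc_eq)
  have fixed: "f j = j" if "j < m" "j \<noteq> k" "j \<noteq> s" for j
    using f_cases[of j] that by (auto simp: code_rank_def)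
  show ?thesis
  proof (cases "s = k")
    case True
    then have kl: "k = l" "\<not> M" "k' = l'" "\<not> M'"
      using c c' kk unfolding s_def s'_def code_rank_def canonical_def by (auto split: if_splits)
    \<comment> \<open>The three elements of rank \<open>k\<close> have the same elements below them,
      so only the least chain element above each can tell them apart.\<close>
    define up up' where "up v = (if v = k then Suc k else if v = m then x else y)"
      and "up' v = (if v = k then Suc k else if v = m then x' else y')" for v
    have up: "up v = up' (f v)" if v: "v = k \<or> v = m \<or> v = Suc m" for v
    proof (rule threshold_eq[where k = k and m = m])
      have fv: "f v = k \<or> f v = m \<or> f v = Suc m"
        using f_cases[of v] v ks True unfolding s_def code_rank_def by auto
      show "up v \<le> j \<longleftrightarrow> up' (f v) \<le> j" if j: "k < j" "j < m" for j
      proof -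
        have "?R v j \<longleftrightarrow> up v \<le> j"
          using v j ks by (auto simp: chain_ext_def up_def)
        moreover have "?R' (f v) (f j) \<longleftrightarrow> up' (f v) \<le> j"
          using fv j ks fixed[of j] True by (auto simp: chain_ext_def up'_def)
        ultimately show ?thesis
          using iso[of v j] v j ks by auto
      qed
    qed (use c c' kl kk in \<open>auto simp: up_def up'_def canonical_def\<close>)
    have f3: "f k = k \<or> f k = m \<or> f k = Suc m" "f m = k \<or> f m = m \<or> f m = Suc m"
      "f (Suc m) = k \<or> f (Suc m) = m \<or> f (Suc m) = Suc m"
      using f_cases[of k] f_cases[of m] f_cases[of "Suc m"] ks True
      unfolding s_def code_rank_def by auto
    have ne: "f k \<noteq> f m" "f k \<noteq> f (Suc m)" "f m \<noteq> f (Suc m)"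
      using inj[of k m] inj[of k "Suc m"] inj[of m "Suc m"] ks by auto
    have bounds: "k < x" "x \<le> y" "k < x'" "x' \<le> y'" "k < m"
      using c c' kl kk unfolding canonical_def by auto
    have ups: "up k = up' (f k)" "up m = up' (f m)" "up (Suc m) = up' (f (Suc m))"
      by (auto intro: up)
    \<comment> \<open>Both triples \<open>(k + 1, x, y)\<close> and \<open>(k + 1, x', y')\<close>
      are sorted and agree up to a permutation, so they are equal; if strict, the permutation is the
      identity.\<close>
    have res: "x = x' \<and> y = y' \<and> (k + 1 < x \<and> x < y \<longrightarrow> f k = k \<and> f m = m \<and> f (Suc m) = Suc m)"
      using ups f3 ne bounds unfolding up_def up'_def by (elim disjE) auto
    moreover have "f u = u" if "rigid_code k l x y M" "u < m + 2" for u
    proof -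
      consider "u = k" | "u = m" | "u = Suc m" | "u < m" "u \<noteq> k"
        using \<open>u < m + 2\<close> by linarith
      then show ?thesis
        using res that kl fixed[of u] True by cases (auto simp: rigid_code_def)
    qed
    ultimately show ?thesis
      using kl kk by auto
  next
    case False
    then have "k < s"
      using ks by simp
    \<comment> \<open>\<open>E\<close> says that the chain element \<open>k\<close> is below
      \<open>m + 1\<close>. With \<open>s\<close> it determines \<open>l\<close>: this is
      \<open>s\<close> under \<open>E\<close> and \<open>k\<close> otherwise.\<close>
    define E E' where "E = (k < l)" and "E' = (k' < l')"
    have sE: "(E \<and> s = l) \<or> (\<not> E \<and> k = l \<and> M \<and> s = Suc k)"
      and sE': "(E' \<and> s = l') \<or> (\<not> E' \<and> k = l' \<and> M' \<and> s = Suc k)"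
      using c c' kk False unfolding s_def s'_def E_def E'_def code_rank_def canonical_def
      by (auto split: if_splits)
    have fk: "f k = k \<and> f m = m \<or> f k = m \<and> f m = k"
      using f_cases[of k] f_cases[of m] inj[of k m] ks False
      unfolding code_rank_def by auto
    have fs: "f s = s \<and> f (Suc m) = Suc m \<or> f s = Suc m \<and> f (Suc m) = s"
      using f_cases[of s] f_cases[of "Suc m"] inj[of s "Suc m"] ks False s_def
      unfolding code_rank_def[of _ _ _ _ s] by auto
    \<comment> \<open>The four comparabilities between the ranks \<open>{k, m}\<close> and
      \<open>{s, m + 1}\<close>; a swap permutes them.\<close>
    have R: "?R k s" "?R m s \<longleftrightarrow> x \<le> s" "?R k (Suc m) \<longleftrightarrow> E" "?R m (Suc m) \<longleftrightarrow> M"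
      "?R' k s" "?R' m s \<longleftrightarrow> x' \<le> s" "?R' k (Suc m) \<longleftrightarrow> E'" "?R' m (Suc m) \<longleftrightarrow> M'"
      using ks kk \<open>k < s\<close> unfolding E_def E'_def by (auto simp: chain_ext_def)
    have Rj: "?R k j" "?R' k j" "?R m j \<longleftrightarrow> x \<le> j" "?R' m j \<longleftrightarrow> x' \<le> j" if "k < j" "j < m" for j
      using ks that by (auto simp: chain_ext_def)
    have Sj: "?R s j" "?R' s j" "?R (Suc m) j \<longleftrightarrow> y \<le> j" "?R' (Suc m) j \<longleftrightarrow> y' \<le> j"
      if "s < j" "j < m" for j
      using ks that by (auto simp: chain_ext_def)
    have bounds: "k < x" "x \<le> m" "k < x'" "x' \<le> m" "s < y" "y \<le> m" "s < y'" "y' \<le> m"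
      using c c' kk sE sE' unfolding canonical_def by auto
    have y_id: "y = y'" if "f (Suc m) = Suc m"
      by (rule threshold_eq[where k = s and m = m]) (use bounds Sj that iso[of "Suc m"] fixed ks in auto)
    \<comment> \<open>The chain element \<open>s\<close> has threshold \<open>s + 1\<close>, and the
      swap passes it to \<open>m + 1\<close> in both codes.\<close>
    have y_swap: "y = Suc s \<and> y' = Suc s" if sw: "f s = Suc m" "f (Suc m) = s"
    proof
      show "y = Suc s"
        by (rule threshold_eq[where k = s and m = m]) (use bounds Sj sw iso[of "Suc m"] fixed ks in auto)
      show "y' = Suc s"
        by (rule threshold_eq[where k = s and m = m]) (use bounds Sj sw iso[of s] fixed ks in auto)
    qed
    have x_id: "x = x'" if "f m = m" "x \<le> s \<longleftrightarrow> x' \<le> s"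
    proof (rule threshold_eq[where k = k and m = m])
      show "x \<le> j \<longleftrightarrow> x' \<le> j" if "k < j" "j < m" for j
        using that \<open>f m = m\<close> \<open>x \<le> s \<longleftrightarrow> x' \<le> s\<close> iso[of m j] fixed[of j] Rj[of j] by (cases "j = s") auto
    qed (use bounds in auto)
    have x_swap: "x \<le> j \<and> x' \<le> j" if "f k = m" "f m = k" "k < j" "j < m" "j \<noteq> s" for j
      using that iso[of m j] iso[of k j] fixed[of j] Rj[of j] ks by auto
    have x_swap': "x = Suc k \<and> x' = Suc k" if "f k = m" "f m = k" "x \<le> s" "x' \<le> s"
      using x_swap[of "Suc k"] that bounds ks \<open>k < s\<close> by (cases "Suc k = s") auto
    have iso4: "?R k s \<longleftrightarrow> ?R' (f k) (f s)" "?R m s \<longleftrightarrow> ?R' (f m) (f s)"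
      "?R k (Suc m) \<longleftrightarrow> ?R' (f k) (f (Suc m))" "?R m (Suc m) \<longleftrightarrow> ?R' (f m) (f (Suc m))"
      using ks by (auto intro!: iso)
    have res: "x = x' \<and> y = y' \<and> E = E' \<and> M = M' \<and> (rigid_code k l x y M \<longrightarrow> f k = k \<and> f s = s)"
      using fk fs
    proof (elim disjE conjE)
      assume f: "f k = k" "f m = m" "f s = s" "f (Suc m) = Suc m"
      have "x \<le> s \<longleftrightarrow> x' \<le> s" "E = E'" "M = M'"
        using iso4 R unfolding f by blast+
      then show ?thesis
        using f x_id y_id by blast
    next
      assume f: "f k = m" "f m = k" "f s = s" "f (Suc m) = Suc m"
      have le: "x \<le> s" "x' \<le> s" "E = M'" "M = E'"
        using iso4 R unfolding f by blast+
      have "x = Suc k" "x' = Suc k" "y = y'"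
        using x_swap' y_id f le by blast+
      \<comment> \<open>If \<open>E\<close> failed, \<open>k = l\<close> and \<open>M\<close> would
        demand \<open>k + 2 \<le> x\<close>, against \<open>x = k + 1\<close>; likewise for
        \<open>E'\<close>. So all four flags hold and the code is not rigid.\<close>
      then show ?thesis
        using f le sE sE' \<open>k < s\<close> c c' kk
        unfolding rigid_code_def E_def E'_def canonical_def by (auto split: if_splits)
    next
      assume f: "f k = k" "f m = m" "f s = Suc m" "f (Suc m) = s"
      have EE: "E" "E'" "x \<le> s \<longleftrightarrow> M'" "M \<longleftrightarrow> x' \<le> s"
        using iso4 R unfolding f by blast+
      have y: "y = Suc s" "y' = Suc s"
        using y_swap f by auto
      \<comment> \<open>With \<open>y = l + 1\<close>, canonicity excludes
        \<open>x = l + 1\<close>.\<close>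
      have "M \<Longrightarrow> x \<le> s" "M' \<Longrightarrow> x' \<le> s"
        using EE(1,2) y sE sE' c c' kk unfolding canonical_def E_def E'_def by auto
      then have le: "x \<le> s \<longleftrightarrow> x' \<le> s"
        using EE(3,4) by blast
      then have "x = x'" "M = M'" "M \<longleftrightarrow> x \<le> s"
        using x_id f EE(3,4) by blast+
      then show ?thesis
        using EE(1,2) y sE by (auto simp: rigid_code_def E_def)
    next
      assume f: "f k = m" "f m = k" "f s = Suc m" "f (Suc m) = s"
      have EE: "M" "M'" "x \<le> s \<longleftrightarrow> E'" "E \<longleftrightarrow> x' \<le> s"
        using iso4 R unfolding f by blast+
      have y: "y = Suc s" "y' = Suc s"
        using y_swap f by auto
      show ?thesis
      proof (cases "x \<le> s \<and> x' \<le> s")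
        case True
        then show ?thesis
          using EE y x_swap'[OF f(1,2)] by (auto simp: rigid_code_def E_def)
      next
        case False
        \<comment> \<open>Without \<open>E\<close>, \<open>s = k + 1\<close> and
          \<open>k + 2 \<le> x\<close>. With the crossed equivalences above, this excludes the mixed
          cases.\<close>
        have "\<not> E \<Longrightarrow> s < x" "\<not> E' \<Longrightarrow> s < x'"
          using sE sE' c c' kk unfolding canonical_def by auto
        then have nE: "\<not> E" "\<not> E'" "s < x" "s < x'"
          using False EE(3,4) by (meson leD)+
        then have "x = Suc s" "x' = Suc s"
          using y sE sE' c c' kk unfolding canonical_def by auto
        then show ?thesis
          using EE(1,2) nE(1,2) y sE by (auto simp: rigid_code_def)
      qed
    qed
    moreover have "f u = u" if "rigid_code k l x y M" "u < m + 2" for u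
    proof -
      have "f k = k" "f s = s" "f m = m" "f (Suc m) = Suc m"
        using res that fk fs ks by auto
      then show ?thesis
        using fixed[of u] that(2) by (cases "u < m"; cases "u = m") (auto simp: less_Suc_eq)
    qed
    moreover have "l = l'"
      using res sE sE' by auto
    ultimately show ?thesis
      using kk by auto
  qed
qed

section \<open>Symmetries of the non-rigid codes\<close>

lemma chain_ext_simps:
  "u < m \<Longrightarrow> v < m \<Longrightarrow> chain_ext m k l x y M u v \<longleftrightarrow> u \<le> v"
  "u < m \<Longrightarrow> chain_ext m k l x y M u m \<longleftrightarrow> u < k"
  "u < m \<Longrightarrow> chain_ext m k l x y M u (Suc m) \<longleftrightarrow> u < l"
  "v < m \<Longrightarrow> chain_ext m k l x y M m v \<longleftrightarrow> x \<le> v"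
  "v < m \<Longrightarrow> chain_ext m k l x y M (Suc m) v \<longleftrightarrow> y \<le> v"
  "chain_ext m k l x y M m (Suc m) \<longleftrightarrow> M"
  "\<not> chain_ext m k l x y M (Suc m) m"
  "chain_ext m k l x y M m m"
  "chain_ext m k l x y M (Suc m) (Suc m)"
  by (auto simp: chain_ext_def)

lemma less_add_2_cases:
  fixes u m :: nat
  assumes "u < m + 2"
  obtains "u < m" | "u = m" | "u = Suc m"
  using assms by linarith

lemma bij_betw_involution:
  assumes "\<And>v. v \<in> A \<Longrightarrow> \<sigma> v \<in> A" "\<And>v. v \<in> A \<Longrightarrow> \<sigma> (\<sigma> v) = v"
  shows "bij_betw \<sigma> A A"
  using assms by (intro bij_betw_byWitness[where f' = \<sigma>]) auto

lemma swap_twins: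
  assumes "a \<in> A" "b \<in> A" "a \<noteq> b" "le a a" "le b b" "\<not> le a b" "\<not> le b a"
    and twins: "\<And>v. v \<in> A \<Longrightarrow> v \<noteq> a \<Longrightarrow> v \<noteq> b \<Longrightarrow> (le a v \<longleftrightarrow> le b v) \<and> (le v a \<longleftrightarrow> le v b)"
  shows "swaps_parallel_chains A le (id(a := b, b := a)) {a}"
proof -
  let ?\<sigma> = "id(a := b, b := a)"
  have "bij_betw ?\<sigma> A A"
    using assms by (intro bij_betw_involution) auto
  moreover have "le u v \<longleftrightarrow> le (?\<sigma> u) (?\<sigma> v)" if "u \<in> A" "v \<in> A" for u v
    using assms(3-7) twins[of u] twins[of v] that by auto
  ultimately have "poset_aut A le ?\<sigma>"
    unfolding poset_aut_def by blast
  moreover have "moved A ?\<sigma> = {a, b}"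
    using assms unfolding moved_def by auto
  ultimately show ?thesis
    using assms unfolding swaps_parallel_chains_def is_chain_def by auto
qed

lemma nonrigid_code_imp_swap:
  assumes c: "canonical m k l x y M" and nr: "\<not> rigid_code k l x y M"
  shows "\<exists>\<sigma> T. swaps_parallel_chains {..<m + 2} (chain_ext m k l x y M) \<sigma> T"
proof -
  let ?R = "chain_ext m k l x y M"
  have km: "k \<le> l" "l < m" "k < x" "x \<le> m" "l < y" "y \<le> m"
    using c unfolding canonical_def by auto
  have twins: ?thesis if "a < m + 2" "b < m + 2" "a \<noteq> b" "\<not> ?R a b" "\<not> ?R b a"
    "\<And>v. v < m \<Longrightarrow> v \<noteq> a \<Longrightarrow> v \<noteq> b \<Longrightarrow> (?R a v \<longleftrightarrow> ?R b v) \<and> (?R v a \<longleftrightarrow> ?R v b)"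
    "\<And>v. v = m \<or> v = Suc m \<Longrightarrow> v \<noteq> a \<Longrightarrow> v \<noteq> b \<Longrightarrow> (?R a v \<longleftrightarrow> ?R b v) \<and> (?R v a \<longleftrightarrow> ?R v b)"
    for a b
  proof -
    have "swaps_parallel_chains {..<m + 2} ?R (id(a := b, b := a)) {a}"
    proof (rule swap_twins)
      fix v assume "v \<in> {..<m + 2}" "v \<noteq> a" "v \<noteq> b"
      then show "(?R a v \<longleftrightarrow> ?R b v) \<and> (?R v a \<longleftrightarrow> ?R v b)"
        using that(6,7)[of v] by (metis lessThan_iff less_add_2_cases)
    qed (use that in \<open>auto simp: chain_ext_def\<close>)
    then show ?thesis
      by blast
  qed
  \<comment> \<open>The equivalences make the twins agree on the remaining point: \<open>k\<close>
    and \<open>m\<close> relate alike to \<open>m + 1\<close> in the first case, \<open>l\<close>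
    and \<open>m + 1\<close> alike to \<open>m\<close> in the third.\<close>
  consider (first) "x = Suc k" "M \<longleftrightarrow> k < l" | (same) "k = l" "\<not> M" "x = y"
    | (second) "k < l" "y = Suc l" "M \<longleftrightarrow> x \<le> l" | (both) "k = l" "M" "x = k + 2" "y = k + 2"
    using c nr unfolding canonical_def rigid_code_def by (auto split: if_splits)
  then show ?thesis
  proof cases
    case first
    then show ?thesis
      using km by (intro twins[of k m]) (auto simp: chain_ext_simps)
  next
    case same
    then show ?thesis
      using km by (intro twins[of m "Suc m"]) (auto simp: chain_ext_simps)
  next
    case second
    then show ?thesis
      using km by (intro twins[of l "Suc m"]) (auto simp: chain_ext_simps)
  next
    case both
    \<comment> \<open>Both chains \<open>k < k + 1\<close> and \<open>m < m + 1\<close> lie above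
      all \<open>i < k\<close> and below all chain elements from \<open>k + 2\<close> on, and they
      are mutually incomparable.\<close>
    let ?\<sigma> = "id(k := m, m := k, Suc k := Suc m, Suc m := Suc k)"
    have "bij_betw ?\<sigma> {..<m + 2} {..<m + 2}"
      using km both by (intro bij_betw_involution) (auto split: if_splits)
    moreover have "?R u v \<longleftrightarrow> ?R (?\<sigma> u) (?\<sigma> v)" if "u < m + 2" "v < m + 2" for u v
      using that(1)
    proof (cases rule: less_add_2_cases)
      case 1
      show ?thesis
        using that(2) by (cases rule: less_add_2_cases) (use 1 km both in \<open>auto simp: chain_ext_simps\<close>)
    next
      case 2
      show ?thesis
        using that(2) by (cases rule: less_add_2_cases) (use 2 km both in \<open>auto simp: chain_ext_simps\<close>)
    next
      case 3
      show ?thesis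
        using that(2) by (cases rule: less_add_2_cases) (use 3 km both in \<open>auto simp: chain_ext_simps\<close>)
    qed
    ultimately have "poset_aut {..<m + 2} ?R ?\<sigma>"
      unfolding poset_aut_def by auto
    moreover have "moved {..<m + 2} ?\<sigma> = {k, Suc k} \<union> ?\<sigma> ` {k, Suc k}"
      using km both unfolding moved_def by auto
    ultimately have "swaps_parallel_chains {..<m + 2} ?R ?\<sigma> {k, Suc k}"
      using km both unfolding swaps_parallel_chains_def is_chain_def
      by (auto simp: chain_ext_simps)
    then show ?thesis
      by blast
  qed
qed

section \<open>Existence of the normal form\<close>

lemma initial_segment_bound:
  fixes P :: "nat \<Rightarrow> bool"
  assumes "\<And>i j. i < j \<Longrightarrow> j < m \<Longrightarrow> P j \<Longrightarrow> P i"
  obtains k where "k \<le> m" "\<And>i. i < m \<Longrightarrow> P i \<longleftrightarrow> i < k"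
proof -
  \<comment> \<open>The disjunct \<open>i = m\<close> provides the value when \<open>P\<close> holds
    on the whole chain.\<close>
  define k where "k = (LEAST i. i = m \<or> \<not> P i)"
  have k: "k = m \<or> \<not> P k"
    unfolding k_def by (rule LeastI[of _ m]) simp
  have "k \<le> m"
    unfolding k_def by (rule Least_le) simp
  moreover have "P i \<longleftrightarrow> i < k" if "i < m" for i
  proof
    show "P i \<Longrightarrow> i < k"
      using k assms[of k i] that by (cases k i rule: linorder_cases) auto
    show "i < k \<Longrightarrow> P i"
      unfolding k_def using not_less_Least by blast
  qed
  ultimately show ?thesis
    using that by blast
qed

lemma final_segment_bound:
  fixes P :: "nat \<Rightarrow> bool"
  assumes "\<And>i j. i < j \<Longrightarrow> j < m \<Longrightarrow> P i \<Longrightarrow> P j"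
  obtains x where "x \<le> m" "\<And>i. i < m \<Longrightarrow> P i \<longleftrightarrow> x \<le> i"
proof -
  obtain x where "x \<le> m" "\<And>i. i < m \<Longrightarrow> \<not> P i \<longleftrightarrow> i < x"
    using initial_segment_bound[of m "\<lambda>i. \<not> P i"] assms by metis
  then show ?thesis
    using that[of x] by (meson not_less)
qed

lemma order_iso_by_involution:
  assumes "\<And>v. v < m + 2 \<Longrightarrow> \<sigma> v < m + 2" "\<And>v. v < m + 2 \<Longrightarrow> \<sigma> (\<sigma> v) = v"
    and "\<And>u v. u < m \<Longrightarrow> v < m \<Longrightarrow> R u v \<longleftrightarrow> R' (\<sigma> u) (\<sigma> v)"
    and "\<And>u. u < m \<Longrightarrow> (R u m \<longleftrightarrow> R' (\<sigma> u) (\<sigma> m)) \<and> (R m u \<longleftrightarrow> R' (\<sigma> m) (\<sigma> u))"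
    and "\<And>u. u < m \<Longrightarrow> (R u (Suc m) \<longleftrightarrow> R' (\<sigma> u) (\<sigma> (Suc m))) \<and>
      (R (Suc m) u \<longleftrightarrow> R' (\<sigma> (Suc m)) (\<sigma> u))"
    and "R m m \<longleftrightarrow> R' (\<sigma> m) (\<sigma> m)" "R m (Suc m) \<longleftrightarrow> R' (\<sigma> m) (\<sigma> (Suc m))"
    and "R (Suc m) m \<longleftrightarrow> R' (\<sigma> (Suc m)) (\<sigma> m)"
    and "R (Suc m) (Suc m) \<longleftrightarrow> R' (\<sigma> (Suc m)) (\<sigma> (Suc m))"
  shows "order_iso {..<m + 2} R {..<m + 2} R'"
proof -
  have "bij_betw \<sigma> {..<m + 2} {..<m + 2}"
    using assms(1,2) by (intro bij_betw_involution) auto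
  moreover have "R u v \<longleftrightarrow> R' (\<sigma> u) (\<sigma> v)" if "u < m + 2" "v < m + 2" for u v
  proof -
    have "u < m \<or> u = m \<or> u = Suc m" "v < m \<or> v = m \<or> v = Suc m"
      using that by auto
    then show ?thesis
      using assms(3-9) by (elim disjE) simp_all
  qed
  ultimately show ?thesis
    unfolding order_iso_def by auto
qed

text \<open>The hypotheses are what transitivity and the height bound give for any chosen longest
  chain. Without \<open>M\<close> the names of the two points may be interchanged; with
  \<open>M\<close> their order is fixed, and the two duplicates are removed by exchanging a point
  with a chain element.\<close>

lemma chain_ext_iso_canonical:
  assumes adm: "k < x" "x \<le> m" "l < y" "y \<le> m" "k \<le> y" "x < l \<Longrightarrow> M"
    and MD: "M \<Longrightarrow> k \<le> l \<and> x \<le> y \<and> k + 2 \<le> y"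
  shows "\<exists>k' l' x' y' M'. canonical m k' l' x' y' M' \<and>
    order_iso {..<m + 2} (chain_ext m k l x y M) {..<m + 2} (chain_ext m k' l' x' y' M')"
proof -
  consider (self) "canonical m k l x y M" | (swap) "\<not> M" "l < k \<or> k = l \<and> y < x"
    | (top) "M" "k < l" "x = Suc l" "y = Suc l" | (bot) "M" "k = l" "x = Suc k"
    using assms unfolding canonical_def 
    by (cases M; cases k l rule: linorder_cases; cases "x \<le> y"; cases "l \<le> x"; cases "Suc (Suc k) \<le> x") auto
  then show ?thesis
  proof cases
    case self
    then show ?thesis
      using order_iso_refl by blast
  next
    case swap
    have "canonical m l k y x False"
      using swap adm unfolding canonical_def by auto
    moreover have "order_iso {..<m + 2} (chain_ext m k l x y M) {..<m + 2} (chain_ext m l k y x False)"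
      using swap
      by (intro order_iso_by_involution[where \<sigma> = "id(m := Suc m, Suc m := m)"])
        (auto simp: chain_ext_simps split: if_splits)
    ultimately show ?thesis
      by blast
  next
    case top
    have "canonical m k l l (Suc l) False"
      using top adm unfolding canonical_def by auto
    moreover have "order_iso {..<m + 2} (chain_ext m k l x y M) {..<m + 2}
        (chain_ext m k l l (Suc l) False)"
      using top adm
      by (intro order_iso_by_involution[where \<sigma> = "id(l := Suc m, Suc m := l)"])
        (auto simp: chain_ext_simps split: if_splits)
    ultimately show ?thesis
      by blast
  next
    case bot
    have "canonical m k (Suc k) (Suc k) y False"
      using bot adm MD unfolding canonical_def by auto
    moreover have "order_iso {..<m + 2} (chain_ext m k l x y M) {..<m + 2}
        (chain_ext m k (Suc k) (Suc k) y False)"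
      using bot adm MD
      by (intro order_iso_by_involution[where \<sigma> = "id(k := m, m := k)"])
        (auto simp: chain_ext_simps split: if_splits)
    ultimately show ?thesis
      by blast
  qed
qed

lemma poset_with_chain_iso_chain_ext:
  assumes po: "po_on {..<m + 2} R" and chain: "\<And>i j. i < m \<Longrightarrow> j < m \<Longrightarrow> R i j \<longleftrightarrow> i \<le> j"
    and not_le: "\<not> R (Suc m) m" and ell: "ell {..<m + 2} R \<le> m"
  shows "\<exists>k l x y M. canonical m k l x y M \<and>
    order_iso {..<m + 2} R {..<m + 2} (chain_ext m k l x y M)"
proof -
  have refl: "R u u" if "u < m + 2" for u
    using po that unfolding po_on_def by blast
  have trans: "R u w" if "R u v" "R v w" "u < m + 2" "v < m + 2" "w < m + 2" for u v w
    using po that unfolding po_on_def by blast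
  have no_chain: "\<not> is_chain C R" if "C \<subseteq> {..<m + 2}" "card C = Suc m" for C
    using card_chain_le_ell[of "{..<m + 2}" C R] that ell by auto
  have down: "R i w" if "i < j" "j < m" "R j w" "w < m + 2" for i j w
    using trans[of i j w] chain[of i j] that by simp
  have up: "R w j" if "i < j" "j < m" "R w i" "w < m + 2" for i j w
    using trans[of w i j] chain[of i j] that by simp
  obtain k where k: "k \<le> m" "\<And>i. i < m \<Longrightarrow> R i m \<longleftrightarrow> i < k"
    using initial_segment_bound[of m "\<lambda>i. R i m"] down by auto
  obtain l where l: "l \<le> m" "\<And>i. i < m \<Longrightarrow> R i (Suc m) \<longleftrightarrow> i < l"
    using initial_segment_bound[of m "\<lambda>i. R i (Suc m)"] down by auto
  obtain x where x: "x \<le> m" "\<And>i. i < m \<Longrightarrow> R m i \<longleftrightarrow> x \<le> i"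
    using final_segment_bound[of m "\<lambda>i. R m i"] up by auto
  obtain y where y: "y \<le> m" "\<And>i. i < m \<Longrightarrow> R (Suc m) i \<longleftrightarrow> y \<le> i"
    using final_segment_bound[of m "\<lambda>i. R (Suc m) i"] up by auto
  define M where "M = R m (Suc m)"
  have "k < x"
  proof (rule ccontr)
    assume "\<not> k < x"
    then have "is_chain (insert m {..<m}) R"
      using k(2) x(2) chain refl by (auto simp: is_chain_def)
    then show False
      using no_chain[of "insert m {..<m}"] by auto
  qed
  have "l < y"
  proof (rule ccontr)
    assume "\<not> l < y"
    then have "is_chain (insert (Suc m) {..<m}) R"
      using l(2) y(2) chain refl by (auto simp: is_chain_def)
    then show False
      using no_chain[of "insert (Suc m) {..<m}"] by auto
  qed
  have "k \<le> y"
  proof (rule ccontr)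
    assume "\<not> k \<le> y"
    then have "R (Suc m) y" "R y m"
      using k y by auto
    then show False
      using trans[of "Suc m" y m] not_le \<open>y \<le> m\<close> by simp
  qed
  have "M" if "x < l"
    using trans[of m x "Suc m"] that x l unfolding M_def by simp
  have M: "k \<le> l \<and> x \<le> y \<and> k + 2 \<le> y" if "M"
  proof -
    have kl: "k \<le> l"
    proof (rule ccontr)
      assume "\<not> k \<le> l"
      then show False
        using trans[of l m "Suc m"] k l that unfolding M_def by auto
    qed
    have xy: "x \<le> y"
    proof (rule ccontr)
      assume "\<not> x \<le> y"
      then show False
        using trans[of m "Suc m" y] x y that unfolding M_def by auto
    qed
    have "k + 2 \<le> y"
    proof (rule ccontr)
      assume y2: "\<not> k + 2 \<le> y"
      \<comment> \<open>Now \<open>l = k\<close> and \<open>x = y = k + 1\<close>, so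
        \<open>k\<close> is the only chain element incomparable to either point; replacing it by
        both points gives a chain that is too long.\<close>
      let ?C = "{m, Suc m} \<union> ({..<m} - {k})"
      have "R i m \<and> R i (Suc m) \<or> R m i \<and> R (Suc m) i" if "i < m" "i \<noteq> k" for i
        using that y2 kl xy k(2) l(2) x(2) y(2) by (cases "i < k") auto
      then have "is_chain ?C R"
        using chain refl that unfolding M_def by (auto simp: is_chain_def)
      moreover have "k < m"
        using \<open>k < x\<close> x(1) by simp
      then have "card ?C = Suc m"
        by (subst card_Un_disjoint) auto
      moreover have "?C \<subseteq> {..<m + 2}"
        by auto
      ultimately show False
        using no_chain by blast
    qed
    then show ?thesis
      using kl xy by blast
  qed
  obtain k' l' x' y' M' where c: "canonical m k' l' x' y' M'"
    and iso: "order_iso {..<m + 2} (chain_ext m k l x y M) {..<m + 2} (chain_ext m k' l' x' y' M')"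
    using chain_ext_iso_canonical[OF \<open>k < x\<close> x(1) \<open>l < y\<close> y(1) \<open>k \<le> y\<close> \<open>x < l \<Longrightarrow> M\<close> M] by blast
  have "order_iso {..<m + 2} R {..<m + 2} (chain_ext m k l x y M)"
    by (rule order_iso_by_involution[where \<sigma> = id])
      (auto simp: chain_ext_simps chain k x l y refl not_le M_def)
  then show ?thesis
    using c iso order_iso_trans by blast
qed

lemma ell_iso_le:
  assumes "finite B" "order_iso A le B le'"
  shows "ell A le \<le> ell B le'"
proof -
  obtain f where f: "bij_betw f A B" "\<And>u v. u \<in> A \<Longrightarrow> v \<in> A \<Longrightarrow> le u v \<longleftrightarrow> le' (f u) (f v)"
    using assms(2) unfolding order_iso_def by blast
  have "finite A"
    using f(1) assms(1) bij_betw_finite by blast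
  then obtain C where C: "C \<subseteq> A" "is_chain C le" "card C = ell A le"
    by (rule ell_witness)
  have "is_chain (f ` C) le'"
    using C f(2) unfolding is_chain_def by (simp add: subset_iff)
  moreover have "f ` C \<subseteq> B" "card (f ` C) = card C"
    using C(1) f(1) by (auto simp: bij_betw_def card_image inj_on_subset)
  ultimately show ?thesis
    using card_chain_le_ell[OF assms(1)] C(3) by metis
qed

lemma poset_iso_canonical:
  assumes po: "po_on {..<m + 2} R" and ell: "ell {..<m + 2} R = m"
  shows "\<exists>k l x y M. canonical m k l x y M \<and>
    order_iso {..<m + 2} R {..<m + 2} (chain_ext m k l x y M)"
proof -
  let ?A = "{..<m + 2}"
  obtain C where C: "C \<subseteq> ?A" "is_chain C R" "card C = m"
    using ell_witness[of ?A R] ell by auto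
  have "finite C"
    using C(1) finite_subset by blast
  obtain g where g: "bij_betw g {..<m} C" "\<And>i j. i < m \<Longrightarrow> j < m \<Longrightarrow> R (g i) (g j) \<longleftrightarrow> i \<le> j"
    using chain_enumeration[OF \<open>finite C\<close> po_on_subset[OF po C(1)] C(2)] C(3) by auto
  have "card (?A - C) = 2"
    using C \<open>finite C\<close> by (simp add: card_Diff_subset)
  then obtain p q where "?A - C = {p, q}" "p \<noteq> q"
    by (auto simp: card_2_iff)
  \<comment> \<open>Antisymmetry allows naming the points so that the second is not below the
    first.\<close>
  then obtain a b where ab: "?A - C = {a, b}" "a \<noteq> b" "\<not> R b a"
    using po unfolding po_on_def by (metis Diff_iff insert_commute insert_iff)
  define h where "h = g(m := a, Suc m := b)"
  have "bij_betw h {..<m} C"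
    using g(1) by (rule bij_betw_cong[THEN iffD1, rotated]) (auto simp: h_def)
  moreover have "bij_betw h {m, Suc m} {a, b}"
    using ab by (auto simp: h_def bij_betw_def)
  ultimately have "bij_betw h ({..<m} \<union> {m, Suc m}) (C \<union> {a, b})"
    using ab by (intro bij_betw_combine) auto
  moreover have "{..<m} \<union> {m, Suc m} = ?A" "C \<union> {a, b} = ?A"
    using ab(1) C(1) by auto
  ultimately have bij: "bij_betw h ?A ?A"
    by simp
  define R' where "R' u v = R (h u) (h v)" for u v
  have iso: "order_iso ?A R' ?A R"
    unfolding order_iso_def R'_def using bij by blast
  have hA: "h u \<in> ?A" if "u \<in> ?A" for u
    using bij that bij_betwE by blast
  have inj: "u = v" if "h u = h v" "u \<in> ?A" "v \<in> ?A" for u v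
    using bij that by (auto simp: bij_betw_def dest: inj_onD)
  have "po_on ?A R'"
    unfolding po_on_def R'_def
  proof (intro conjI ballI impI)
    fix u assume "u \<in> ?A"
    then show "R (h u) (h u)"
      using po hA unfolding po_on_def by blast
  next
    fix u v assume "u \<in> ?A" "v \<in> ?A" "R (h u) (h v) \<and> R (h v) (h u)"
    then show "u = v"
      using po hA inj unfolding po_on_def by blast
  next
    fix u v w assume "u \<in> ?A" "v \<in> ?A" "w \<in> ?A" "R (h u) (h v) \<and> R (h v) (h w)"
    then show "R (h u) (h w)"
      using po hA unfolding po_on_def by blast
  qed
  moreover have "R' i j \<longleftrightarrow> i \<le> j" if "i < m" "j < m" for i j
    using g(2) that by (simp add: R'_def h_def)
  moreover have "\<not> R' (Suc m) m"
    using ab by (simp add: R'_def h_def)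
  moreover have "ell ?A R' \<le> m"
    using ell_iso_le[OF _ iso] ell by simp
  ultimately obtain k l x y M where "canonical m k l x y M" "order_iso ?A R' ?A (chain_ext m k l x y M)"
    using poset_with_chain_iso_chain_ext[of m R'] by blast
  then show ?thesis
    using order_iso_trans[OF order_iso_sym[OF iso]] by blast
qed

section \<open>Counting\<close>

text \<open>The bound \<open>l \<le> N\<close> keeps the natural subtraction from being truncated,
  so that a closed form over the reals holds.\<close>

lemma sum_diff_index:
  assumes "l \<le> N"
  shows "real (\<Sum>k<l. N - k) = real l * real N - real l * (real l - 1) / 2"
  using assms by (induction l) (simp_all add: field_simps of_nat_diff)

lemma sum_sum_diff_index:
  assumes "j \<le> N"
  shows "real (\<Sum>l<j. \<Sum>k<l. N - k) =
    real N * real j * (real j - 1) / 2 - real j * (real j - 1) * (real j - 2) / 6"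
  using assms
proof (induction j)
  case (Suc j)
  then have "real (\<Sum>l<Suc j. \<Sum>k<l. N - k) = real N * real j * (real j - 1) / 2
      - real j * (real j - 1) * (real j - 2) / 6 + (real j * real N - real j * (real j - 1) / 2)"
    using sum_diff_index[of j N] by (simp del: of_nat_sum add: of_nat_add)
  then show ?case
    by (simp add: field_simps)
qed simp

section \<open>Enumeration of the codes\<close>

definition code_set :: "nat \<Rightarrow> (nat \<times> nat \<times> nat \<times> nat \<times> bool) set" where
  "code_set m = {(k, l, x, y, M). canonical m k l x y M}"

definition rigid_code_set :: "nat \<Rightarrow> (nat \<times> nat \<times> nat \<times> nat \<times> bool) set" where
  "rigid_code_set m = {(k, l, x, y, M). canonical m k l x y M \<and> rigid_code k l x y M}"

text \<open>Each piece ranges over nested intervals, so its size is an iterated sum. For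
  \<open>k < l\<close> with \<open>M\<close>, the case \<open>y = l + 1\<close> is split off because
  there \<open>x \<le> l\<close> replaces \<open>x \<le> y\<close>; in the last piece
  \<open>j = y - 1\<close>.\<close>

lemma code_set_decomp:
  "code_set m =
     (\<lambda>(y, x, k). (k, k, x, y, False)) ` (SIGMA y:{..m}. SIGMA x:{..y}. {..<x}) \<union>
     (\<lambda>(y, x, k). (k, k, x, y, True)) ` (SIGMA y:{..m}. SIGMA x:{..y}. {..<x - 1}) \<union>
     (\<lambda>(l, k, x, y). (k, l, x, y, False)) ` (SIGMA l:{..<m}. {..<l} \<times> {l..m} \<times> {l<..m}) \<union>
     (\<lambda>(l, k, x). (k, l, x, Suc l, True)) ` (SIGMA l:{..<m}. SIGMA k:{..<l}. {k<..l}) \<union>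
     (\<lambda>(j, l, k, x). (k, l, x, Suc j, True)) `
       (SIGMA j:{..<m}. SIGMA l:{..<j}. SIGMA k:{..<l}. {k<..Suc j})"
  (is "_ = ?S1 \<union> ?S2 \<union> ?S3 \<union> ?S4 \<union> ?S5")
proof (intro equalityI subsetI)
  fix c assume "c \<in> code_set m"
  then obtain k l x y M where c: "c = (k, l, x, y, M)" and can: "canonical m k l x y M"
    unfolding code_set_def by auto
  consider "k = l" "\<not> M" | "k = l" "M" | "k < l" "\<not> M" | "k < l" "M" "y = Suc l" | "k < l" "M" "y \<noteq> Suc l"
    using can unfolding canonical_def by linarith
  then show "c \<in> ?S1 \<union> ?S2 \<union> ?S3 \<union> ?S4 \<union> ?S5"
  proof cases
    case 1
    then have "c \<in> ?S1"
      using can c unfolding canonical_def by (intro image_eqI[of _ _ "(y, x, k)"]) auto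
    then show ?thesis by blast
  next
    case 2
    then have "c \<in> ?S2"
      using can c unfolding canonical_def by (intro image_eqI[of _ _ "(y, x, k)"]) auto
    then show ?thesis by blast
  next
    case 3
    then have "c \<in> ?S3"
      using can c unfolding canonical_def by (intro image_eqI[of _ _ "(l, k, x, y)"]) auto
    then show ?thesis by blast
  next
    case 4
    then have "c \<in> ?S4"
      using can c unfolding canonical_def by (intro image_eqI[of _ _ "(l, k, x)"]) auto
    then show ?thesis by blast
  next
    case 5
    then have "c \<in> ?S5"
      using can c unfolding canonical_def by (intro image_eqI[of _ _ "(y - 1, l, k, x)"]) auto
    then show ?thesis by blast
  qed
next
  fix c assume "c \<in> ?S1 \<union> ?S2 \<union> ?S3 \<union> ?S4 \<union> ?S5"
  then show "c \<in> code_set m"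
    unfolding code_set_def canonical_def by (elim UnE) auto
qed

text \<open>Rigidity makes \<open>y > l + 1\<close> whenever \<open>k < l\<close> and
  \<open>M\<close>, so the excluded duplicate cannot occur and one piece suffices there. The shifts
  of \<open>x\<close> and \<open>y\<close> let the intervals start right after \<open>k\<close> and
  \<open>l\<close>.\<close>

lemma rigid_code_set_decomp:
  "rigid_code_set (Suc m) =
     (\<lambda>(y, x, k). (k, k, x, y, False)) ` (SIGMA y:{..Suc m}. SIGMA x:{..<y}. {..<x - 1}) \<union>
     (\<lambda>(j, k, x). (k, k, Suc x, j + 2, True)) ` (SIGMA j:{..<m}. SIGMA k:{..<j}. {k<..Suc j}) \<union>
     (\<lambda>(l, k, x, y). (k, l, x, y, False)) ` (SIGMA l:{..<Suc m}. {..<l} \<times>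
       ({l} \<times> {l<..Suc m} \<union> {l<..Suc m} \<times> {Suc l<..Suc m})) \<union>
     (\<lambda>(j, l, k, x). (k, l, Suc x, Suc j, True)) `
       (SIGMA j:{..<Suc m}. SIGMA l:{..<j}. SIGMA k:{..<l}. {k<..j})"
  (is "_ = ?S1 \<union> ?S2 \<union> ?S3 \<union> ?S4")
proof (intro equalityI subsetI)
  fix c assume "c \<in> rigid_code_set (Suc m)"
  then obtain k l x y M where c: "c = (k, l, x, y, M)" and can: "canonical (Suc m) k l x y M"
      "rigid_code k l x y M"
    unfolding rigid_code_set_def by auto
  consider "k = l" "\<not> M" | "k = l" "M" | "k < l" "\<not> M" | "k < l" "M"
    using can unfolding canonical_def by linarith
  then show "c \<in> ?S1 \<union> ?S2 \<union> ?S3 \<union> ?S4"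
  proof cases
    case 1
    then have "c \<in> ?S1"
      using can c unfolding canonical_def rigid_code_def
      by (intro image_eqI[of _ _ "(y, x, k)"]) auto
    then show ?thesis by blast
  next
    case 2
    then have "c \<in> ?S2"
      using can c unfolding canonical_def rigid_code_def
      by (intro image_eqI[of _ _ "(y - 2, k, x - 1)"]) auto
    then show ?thesis by blast
  next
    case 3
    then have "c \<in> ?S3"
      using can c unfolding canonical_def rigid_code_def
      by (intro image_eqI[of _ _ "(l, k, x, y)"]) auto
    then show ?thesis by blast
  next
    case 4
    then have "c \<in> ?S4"
      using can c unfolding canonical_def rigid_code_def
      by (intro image_eqI[of _ _ "(y - 1, l, k, x - 1)"]) auto
    then show ?thesis by blast
  qed
next
  fix c assume "c \<in> ?S1 \<union> ?S2 \<union> ?S3 \<union> ?S4"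
  then show "c \<in> rigid_code_set (Suc m)"
    unfolding rigid_code_set_def canonical_def rigid_code_def by (elim UnE) auto
qed

lemma card_code_set_sum:
  "card (code_set m) = (\<Sum>y\<le>m. \<Sum>x\<le>y. x) + (\<Sum>y\<le>m. \<Sum>x\<le>y. x - 1) +
     (\<Sum>l<m. l * ((Suc m - l) * (m - l))) + (\<Sum>l<m. \<Sum>k<l. l - k) +
     (\<Sum>j<m. \<Sum>l<j. \<Sum>k<l. Suc j - k)"
  unfolding code_set_decomp
  apply (subst card_Un_disjoint, simp, simp, fastforce)+
  apply (subst card_image, force simp: inj_on_def)+
  apply (simp add: card_SigmaI)
  done

lemma card_rigid_code_set_sum:
  "card (rigid_code_set (Suc m)) = (\<Sum>y\<le>Suc m. \<Sum>x<y. x - 1) + (\<Sum>j<m. \<Sum>k<j. Suc j - k) +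
     (\<Sum>l<Suc m. l * ((Suc m - l) + (Suc m - l) * (m - l))) + (\<Sum>j<Suc m. \<Sum>l<j. \<Sum>k<l. j - k)"
proof -
  have "card ({l} \<times> {l<..Suc m} \<union> {l<..Suc m} \<times> {Suc l<..Suc m}) =
    (Suc m - l) + (Suc m - l) * (m - l)" for l
    by (subst card_Un_disjoint) auto
  then show ?thesis
    unfolding rigid_code_set_decomp
    apply (subst card_Un_disjoint, simp, simp, fastforce)+
    apply (subst card_image, force simp: inj_on_def)+
    apply (simp add: card_SigmaI)
    done
qed

lemma sum_sum_index: "real (\<Sum>y\<le>m. \<Sum>x\<le>y. x) = real m * (real m + 1) * (real m + 2) / 6"
proof -
  have "real (\<Sum>x\<le>y. x) = real y * (real y + 1) / 2" for y
    by (induction y) (simp_all add: field_simps)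
  then have "real (\<Sum>y\<le>m. \<Sum>x\<le>y. x) = (\<Sum>y\<le>m. real y * (real y + 1) / 2)"
    by (simp only: of_nat_sum)
  also have "\<dots> = real m * (real m + 1) * (real m + 2) / 6"
    by (induction m) (simp_all add: field_simps)
  finally show ?thesis .
qed

lemma sum_sum_index_pred: "real (\<Sum>y\<le>m. \<Sum>x\<le>y. x - 1) = (real m + 1) * real m * (real m - 1) / 6"
proof -
  have "real (\<Sum>x\<le>y. x - 1) = real y * (real y - 1) / 2" for y
    by (induction y) (simp_all add: field_simps)
  then have "real (\<Sum>y\<le>m. \<Sum>x\<le>y. x - 1) = (\<Sum>y\<le>m. real y * (real y - 1) / 2)"
    by (simp only: of_nat_sum)
  also have "\<dots> = (real m + 1) * real m * (real m - 1) / 6"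
    by (induction m) (simp_all add: field_simps)
  finally show ?thesis .
qed

lemma card_code_set:
  "6 * real (card (code_set m)) =
    real m * ((real m + 2)^3 - 2 * (real m + 2)^2 - 5 * (real m + 2) + 12)"
proof -
  have S3: "real (\<Sum>l<m. l * ((Suc m - l) * (m - l))) =
      (real m * real m + real m) * (real m * (real m - 1) / 2) -
      (2 * real m + 1) * (real m * (real m - 1) * (2 * real m - 1) / 6) + (real m * (real m - 1) / 2)^2"
  proof -
    have "real (\<Sum>l<m. l * ((Suc m - l) * (m - l))) =
        (\<Sum>l<m. real l * ((real m + 1 - real l) * (real m - real l)))"
      unfolding of_nat_sum by (intro sum.cong) (auto simp: of_nat_diff)
    \<comment> \<open>The limit \<open>n\<close> is separated from \<open>c\<close> because an
      induction on \<open>m\<close> would change the summand too. The summand expands to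
      \<open>(c * c + c) * l - (2 * c + 1) * l^2 + l^3\<close>, hence three power sums.\<close>
    also have "(\<Sum>l<n. real l * ((c + 1 - real l) * (c - real l))) =
        (c * c + c) * (real n * (real n - 1) / 2) -
        (2 * c + 1) * (real n * (real n - 1) * (2 * real n - 1) / 6) + (real n * (real n - 1) / 2)^2"
      for n and c :: real
      by (induction n) (simp_all add: field_simps power2_eq_square)
    finally show ?thesis .
  qed
  have S4: "real (\<Sum>l<m. \<Sum>k<l. l - k) = (real m - 1) * real m * (real m + 1) / 6"
  proof -
    have "real (\<Sum>l<m. \<Sum>k<l. l - k) = (\<Sum>l<m. real l * real l - real l * (real l - 1) / 2)"
      unfolding of_nat_sum[of _ "{..<m}"] by (intro sum.cong refl sum_diff_index) simp
    also have "\<dots> = (real m - 1) * real m * (real m + 1) / 6"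
      by (induction m) (simp_all add: field_simps)
    finally show ?thesis .
  qed
  have S5: "real (\<Sum>j<m. \<Sum>l<j. \<Sum>k<l. Suc j - k) =
      real m * (real m - 1) * (real m - 2) * (2 * real m + 6) / 24"
  proof -
    have "real (\<Sum>j<m. \<Sum>l<j. \<Sum>k<l. Suc j - k) = (\<Sum>j<m.
        real (Suc j) * real j * (real j - 1) / 2 - real j * (real j - 1) * (real j - 2) / 6)"
      unfolding of_nat_sum[of _ "{..<m}"] by (intro sum.cong refl sum_sum_diff_index) simp
    also have "\<dots> = real m * (real m - 1) * (real m - 2) * (2 * real m + 6) / 24"
      by (induction m) (simp_all add: field_simps)
    finally show ?thesis .
  qed
  show ?thesis
    unfolding card_code_set_sum of_nat_add S3 S4 S5 sum_sum_index sum_sum_index_pred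
    by (simp add: field_simps power2_eq_square power3_eq_cube)
qed

lemma card_rigid_code_set:
  "6 * real (card (rigid_code_set (Suc m))) =
    real m * ((real m + 3)^3 - 4 * (real m + 3)^2 + 2 * (real m + 3) - 2)"
proof -
  have S1: "(\<Sum>y\<le>Suc m. \<Sum>x<y. x - 1) = (\<Sum>y\<le>m. \<Sum>x\<le>y. x - 1)"
    by (subst sum.atMost_Suc_shift) (simp add: lessThan_Suc_atMost)
  have S2: "real (\<Sum>j<m. \<Sum>k<j. Suc j - k) = real m * (real m - 1) * (real m + 4) / 6"
  proof -
    have "real (\<Sum>j<m. \<Sum>k<j. Suc j - k) = (\<Sum>j<m. real j * real (Suc j) - real j * (real j - 1) / 2)"
      unfolding of_nat_sum[of _ "{..<m}"] by (intro sum.cong refl sum_diff_index) simp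
    also have "\<dots> = real m * (real m - 1) * (real m + 4) / 6"
      by (induction m) (simp_all add: field_simps)
    finally show ?thesis .
  qed
  let ?c = "real (Suc m)"
  have S3: "real (\<Sum>l<Suc m. l * ((Suc m - l) + (Suc m - l) * (m - l))) =
      ?c * ?c * (?c * (?c - 1) / 2) - 2 * ?c * (?c * (?c - 1) * (2 * ?c - 1) / 6) + (?c * (?c - 1) / 2)^2"
  proof -
    have "real (\<Sum>l<Suc m. l * ((Suc m - l) + (Suc m - l) * (m - l))) =
        (\<Sum>l<Suc m. real l * ((?c - real l) * (?c - real l)))"
      unfolding of_nat_sum
    proof (intro sum.cong refl)
      \<comment> \<open>With \<open>m = l + d\<close> the bracket is
        \<open>(d + 1) + (d + 1) * d = (d + 1)^2\<close>.\<close>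
      fix l assume "l \<in> {..<Suc m}"
      then obtain d where "m = l + d"
        using le_Suc_ex[of l m] by auto
      then show "real (l * ((Suc m - l) + (Suc m - l) * (m - l))) = real l * ((?c - real l) * (?c - real l))"
        by (simp add: Suc_diff_le algebra_simps)
    qed
    also have "(\<Sum>l<n. real l * ((c - real l) * (c - real l))) =
        c * c * (real n * (real n - 1) / 2) - 2 * c * (real n * (real n - 1) * (2 * real n - 1) / 6) +
        (real n * (real n - 1) / 2)^2" for n and c :: real
      by (induction n) (simp_all add: field_simps power2_eq_square)
    finally show ?thesis .
  qed
  have S4: "real (\<Sum>j<n. \<Sum>l<j. \<Sum>k<l. j - k) =
      (real n + 1) * real n * (real n - 1) * (real n - 2) / 12" for n
  proof -
    have "real (\<Sum>j<n. \<Sum>l<j. \<Sum>k<l. j - k) = (\<Sum>j<n.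
        real j * real j * (real j - 1) / 2 - real j * (real j - 1) * (real j - 2) / 6)"
      unfolding of_nat_sum[of _ "{..<n}"] by (intro sum.cong refl sum_sum_diff_index) simp
    also have "\<dots> = (real n + 1) * real n * (real n - 1) * (real n - 2) / 12"
      by (induction n) (simp_all add: field_simps)
    finally show ?thesis .
  qed
  show ?thesis
    unfolding card_rigid_code_set_sum of_nat_add S1 S2 S3 S4 sum_sum_index_pred
    by (simp add: field_simps power2_eq_square power3_eq_cube)
qed

section \<open>From isomorphism classes to codes\<close>

definition code_poset :: "nat \<Rightarrow> nat \<times> nat \<times> nat \<times> nat \<times> bool \<Rightarrow> nat \<Rightarrow> nat \<Rightarrow> bool" where
  "code_poset m = (\<lambda>(k, l, x, y, M). chain_ext m k l x y M)"

text \<open>\<open>F\<close> picks exactly one representative in \<open>X\<close> from each class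
  that meets \<open>X\<close>.\<close>

lemma card_quotient_iso_rel:
  assumes X: "X \<subseteq> posets n" and F: "F ` K \<subseteq> X"
    and surj: "\<And>R. R \<in> X \<Longrightarrow> \<exists>c\<in>K. order_iso {..<n} R {..<n} (F c)"
    and inj: "\<And>c d. c \<in> K \<Longrightarrow> d \<in> K \<Longrightarrow> order_iso {..<n} (F c) {..<n} (F d) \<Longrightarrow> c = d"
  shows "card (X // iso_rel n) = card K"
proof -
  have rel: "(R, S) \<in> iso_rel n \<longleftrightarrow> R \<in> posets n \<and> S \<in> posets n \<and> order_iso {..<n} R {..<n} S" for R S
    unfolding iso_rel_def by blast
  have "equiv (posets n) (iso_rel n)"
  proof (rule equivI)
    show "iso_rel n \<subseteq> posets n \<times> posets n"
      unfolding iso_rel_def by blast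
    show "refl_on (posets n) (iso_rel n)"
      unfolding refl_on_def rel using order_iso_refl by auto
    show "sym (iso_rel n)"
      unfolding sym_def rel using order_iso_sym by blast
    show "trans (iso_rel n)"
      unfolding trans_def rel using order_iso_trans by blast
  qed
  note class_eq = eq_equiv_class_iff[OF this]
  have FK: "F c \<in> X" "F c \<in> posets n" if "c \<in> K" for c
    using that F X by auto
  have "X // iso_rel n = (\<lambda>c. iso_rel n `` {F c}) ` K"
  proof (intro equalityI subsetI)
    fix E assume "E \<in> X // iso_rel n"
    then obtain R where R: "R \<in> X" "E = iso_rel n `` {R}"
      by (rule quotientE)
    then obtain c where "c \<in> K" "order_iso {..<n} R {..<n} (F c)"
      using surj by blast
    then show "E \<in> (\<lambda>c. iso_rel n `` {F c}) ` K"
      using R class_eq[of R "F c"] FK X rel by blast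
  next
    fix E assume "E \<in> (\<lambda>c. iso_rel n `` {F c}) ` K"
    then show "E \<in> X // iso_rel n"
      using FK(1) by (auto intro: quotientI)
  qed
  moreover have "inj_on (\<lambda>c. iso_rel n `` {F c}) K"
  proof (rule inj_onI)
    fix c d assume cd: "c \<in> K" "d \<in> K" "iso_rel n `` {F c} = iso_rel n `` {F d}"
    have "(F c, F d) \<in> iso_rel n"
      using class_eq[OF FK(2)[OF cd(1)] FK(2)[OF cd(2)]] cd(3) by (rule iffD1)
    then have "order_iso {..<n} (F c) {..<n} (F d)"
      unfolding rel by (elim conjE)
    then show "c = d"
      by (rule inj[OF cd(1,2)])
  qed
  ultimately show ?thesis
    by (simp add: card_image)
qed

lemma code_poset_iso_unique:
  assumes "c \<in> code_set m" "d \<in> code_set m"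
    and "order_iso {..<m + 2} (code_poset m c) {..<m + 2} (code_poset m d)"
  shows "c = d"
proof -
  obtain f where "bij_betw f {..<m + 2} {..<m + 2}"
    "\<forall>u\<in>{..<m + 2}. \<forall>v\<in>{..<m + 2}. code_poset m c u v \<longleftrightarrow> code_poset m d (f u) (f v)"
    using assms(3) unfolding order_iso_def by blast
  moreover obtain k l x y M where "c = (k, l, x, y, M)"
    by (cases c)
  moreover obtain k' l' x' y' M' where "d = (k', l', x', y', M')"
    by (cases d)
  ultimately show ?thesis
    using assms(1,2) chain_ext_iso_unique[of m k l x y M k' l' x' y' M' f]
    unfolding code_set_def code_poset_def by simp
qed

lemma p_count_eq: "p_count (m + 2) (int m) = card (code_set m)"
  unfolding p_count_def
proof (rule card_quotient_iso_rel[where F = "code_poset m"])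
  show "code_poset m ` code_set m \<subseteq> {le \<in> posets (m + 2). int (ell {..<m + 2} le) = int m}"
    using chain_ext_in_posets ell_chain_ext unfolding code_poset_def code_set_def by auto
  show "\<exists>c\<in>code_set m. order_iso {..<m + 2} R {..<m + 2} (code_poset m c)"
    if "R \<in> {le \<in> posets (m + 2). int (ell {..<m + 2} le) = int m}" for R
    using poset_iso_canonical[of m R] that unfolding code_poset_def code_set_def posets_def by auto
qed (use code_poset_iso_unique in auto)

text \<open>Rigid codes give rigid posets by uniqueness applied to a code and itself. Conversely,
  the exchange on a non-rigid normal form is carried back to \<open>R\<close>, contradicting local
  unsymmetry.\<close>

lemma u_count_eq: "u_count (m + 2) (int m) = card (rigid_code_set m)"
  unfolding u_count_def
proof (rule card_quotient_iso_rel[where F = "code_poset m"])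
  let ?X = "{le \<in> posets (m + 2). int (ell {..<m + 2} le) = int m \<and> locally_unsymmetric {..<m + 2} le}"
  show "code_poset m ` rigid_code_set m \<subseteq> ?X"
  proof clarify
    fix k l x y M
    assume "(k, l, x, y, M) \<in> rigid_code_set m"
    then have c: "canonical m k l x y M" "rigid_code k l x y M"
      unfolding rigid_code_set_def by auto
    have "rigid {..<m + 2} (chain_ext m k l x y M)"
      unfolding rigid_def poset_aut_def using chain_ext_iso_unique[OF c(1) c(1)] c(2) by auto
    then show "code_poset m (k, l, x, y, M) \<in> posets (m + 2) \<and>
        int (ell {..<m + 2} (code_poset m (k, l, x, y, M))) = int m \<and>
        locally_unsymmetric {..<m + 2} (code_poset m (k, l, x, y, M))"
      using chain_ext_in_posets[OF c(1)] ell_chain_ext[OF c(1)] rigid_imp_locally_unsymmetric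
      unfolding code_poset_def by auto
  qed
  show "\<exists>c\<in>rigid_code_set m. order_iso {..<m + 2} R {..<m + 2} (code_poset m c)" if R: "R \<in> ?X" for R
  proof -
    have po: "po_on {..<m + 2} R"
      using R unfolding posets_def by simp
    then obtain k l x y M where c: "canonical m k l x y M"
      and iso: "order_iso {..<m + 2} R {..<m + 2} (chain_ext m k l x y M)"
      using poset_iso_canonical[of m R] R by auto
    have "rigid_code k l x y M"
    proof (rule ccontr)
      assume "\<not> rigid_code k l x y M"
      then obtain \<sigma> T where "swaps_parallel_chains {..<m + 2} R \<sigma> T"
        using nonrigid_code_imp_swap[OF c] swaps_parallel_chains_iso[OF order_iso_sym[OF iso]] by blast
      then have "locally_symmetric {..<m + 2} R"
        using swaps_parallel_chains_imp_locally_symmetric po by blast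
      then show False
        using R unfolding locally_unsymmetric_def by blast
    qed
    then show ?thesis
      using c iso unfolding rigid_code_set_def code_poset_def
      by (intro bexI[of _ "(k, l, x, y, M)"]) auto
  qed
  show "c = d" if "c \<in> rigid_code_set m" "d \<in> rigid_code_set m"
    "order_iso {..<m + 2} (code_poset m c) {..<m + 2} (code_poset m d)" for c d
    using that code_poset_iso_unique unfolding rigid_code_set_def code_set_def by blast
qed auto

theorem mainTheorem14:
  shows "(\<forall>n::nat. n < 3 \<longrightarrow> p_count n (int n - 2) = 0 \<and> u_count n (int n - 2) = 0) \<and>
    (\<forall>n::nat. 3 \<le> n \<longrightarrow>
       real (p_count n (int n - 2)) =
         (1/6) * (real n - 2) * ((real n)^3 - 2 * (real n)^2 - 5 * real n + 12) \<and>
       real (u_count n (int n - 2)) =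
         (1/6) * (real n - 3) * ((real n)^3 - 4 * (real n)^2 + 2 * real n - 2))"
proof (intro conjI allI impI)
  \<comment> \<open>This settles \<open>n = 2\<close>, where the required height is 0; for
    \<open>n < 2\<close> it is negative.\<close>
  have empty: "code_set 0 = {}" "rigid_code_set 0 = {}"
    unfolding code_set_def rigid_code_set_def canonical_def by auto
  have negative: "p_count n l = 0" "u_count n l = 0" if "l < 0" for n l
    using that unfolding p_count_def u_count_def by (auto simp: quotient_def)
  fix n :: nat
  assume "n < 3"
  then consider "int n - 2 < 0" | "n = 0 + 2" "int n - 2 = int 0"
    by linarith
  then have "p_count n (int n - 2) = 0 \<and> u_count n (int n - 2) = 0"
  proof cases
    case 1
    then show ?thesis
      using negative by blast
  next
    case 2
    show ?thesis
      unfolding 2(2) unfolding 2(1) p_count_eq u_count_eq empty by simp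
  qed
  then show "p_count n (int n - 2) = 0" "u_count n (int n - 2) = 0"
    by blast+
next
  fix n :: nat
  assume n: "3 \<le> n"
  define m where "m = n - 3"
  have m: "n = Suc m + 2"
    using n unfolding m_def by simp
  then have l: "int n - 2 = int (Suc m)" "real n = real m + 3"
    by auto
  show "real (p_count n (int n - 2)) =
      (1/6) * (real n - 2) * ((real n)^3 - 2 * (real n)^2 - 5 * real n + 12)"
    using card_code_set[of "Suc m"] unfolding l(1) unfolding m p_count_eq by (simp add: add.commute)
  show "real (u_count n (int n - 2)) =
      (1/6) * (real n - 3) * ((real n)^3 - 4 * (real n)^2 + 2 * real n - 2)"
    using card_rigid_code_set[of m] unfolding l(1) unfolding m u_count_eq by (simp add: add.commute)
qed

end
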